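(* For any knot $K$ in $\mathbb{S}^3$ (given by an $n$-crossing diagram $D_K$), there is a ring isomorphism $$(HC_0^{ab}(K)\otimes\mathbb{C})/\sqrt{0}\;\cong\;\mathbf{C}[F_2(K)],$$ where $\sqrt0$ is the nilradical of $HC_0^{ab}(K)\otimes\mathbb{C}$.
   Context: Let the arcs of $D_K$ be labelled $1,\dots,n$. At each crossing with overarc $i$ and underarcs $j,k$ (labelled so that $j<k$), $(i,j,k)$ is called a Wirtinger triple. The degree $0$ abelian knot contact homology of $K$ is the ring $$HC_0^{ab}(K)=\mathbb{Z}[a_{ij}\mid 1\le i<j\le n]\big/\big\langle a_{lj}+a_{lk}+a_{li}a_{ij}\ \big|\ (i,j,k)\text{ any Wirtinger triple},\ 1\le l\le n\big\rangle,$$ with the convention $a_{ii}=-2$ and $a_{ji}=a_{ij}$; the tensor product is over $\mathbb{Z}$. The fundamental variety $F_2(K)\subset\mathbb{C}^{\binom n2}$ is the set of points $(x_{ij})_{1\le i<j\le n}$ such that $x_{ak}-x_{ij}x_{ai}+x_{aj}=0$ for every Wirtinger triple $(i,j,k)$ and every $1\le a\le n$, with the convention $x_{ii}=2$, $x_{ji}=x_{ij}$. For an algebraic set $V\subset\mathbb{C}^N$, $\mathbf{C}[V]$ is the coordinate ring, i.e. $\mathbb{C}[z_1,\dots,z_N]$ modulo the (radical) ideal of polynomials vanishing on $V$. *)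

theory Defs
  imports
    "HOL-Analysis.Analysis"
    "HOL-Library.Poly_Mapping"
    "HOL-Algebra.QuotRing"
    "HOL-Algebra.Algebraic_Closure_Type"
begin

section \<open>Knots and knot diagrams\<close>

text \<open>
  We regard \<open>S\<^sup>3\<close> as \<open>\<real>\<^sup>3 \<union> {\<infinity>}\<close> and take knots off \<open>\<infinity>\<close>.  A diagram of a
  knot is the projection of a representative in general position (\<open>regular_projection\<close> below).  Space is split as
  plane \<open>\<times>\<close> height, so that \<^const>\<open>fst\<close> is the projection to the plane of the diagram and \<^const>\<open>snd\<close>
  decides which strand is on top.
\<close>

type_synonym space = "(real^2) \<times> real"

text \<open>The equivalence below says both that the curve has period 1 and that it is injective on
  a period, so that it is a \<open>C\<^sup>1\<close> embedding of the circle \<open>\<real>/\<int>\<close>.\<close>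

definition knot_parametrization :: "(real \<Rightarrow> space) \<Rightarrow> space set \<Rightarrow> bool" where
  "knot_parametrization \<gamma> K \<longleftrightarrow>
     \<gamma> C1_differentiable_on UNIV \<and>
     (\<forall>t. vector_derivative \<gamma> (at t) \<noteq> 0) \<and>
     (\<forall>s t. \<gamma> s = \<gamma> t \<longleftrightarrow> s - t \<in> \<int>) \<and>
     K = range \<gamma>"

definition knot :: "space set \<Rightarrow> bool" where
  "knot K \<longleftrightarrow> (\<exists>\<gamma>. knot_parametrization \<gamma> K)"

text \<open>\<open>K\<close> is in general position with respect to the projection: the projected curve is an immersion
  whose only self-intersections are transverse double points.  (By compactness there are then only
  finitely many of them.)\<close>

definition regular_projection :: "space set \<Rightarrow> bool" where
  "regular_projection K \<longleftrightarrow>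
     (\<exists>\<gamma>. knot_parametrization \<gamma> K \<and>
       (\<forall>t. vector_derivative (fst \<circ> \<gamma>) (at t) \<noteq> 0) \<and>
       (\<forall>s t. fst (\<gamma> s) = fst (\<gamma> t) \<and> \<gamma> s \<noteq> \<gamma> t \<longrightarrow>
          span {vector_derivative (fst \<circ> \<gamma>) (at s), vector_derivative (fst \<circ> \<gamma>) (at t)} = UNIV)) \<and>
     (\<forall>p\<in>K. \<forall>q\<in>K. \<forall>r\<in>K. fst p = fst q \<and> fst q = fst r \<longrightarrow> p = q \<or> q = r \<or> p = r)"

text \<open>\<open>p\<close> and \<open>q\<close> are the points of \<open>K\<close> on the over- and understrand of a crossing.\<close>

definition crossing :: "space set \<Rightarrow> space \<Rightarrow> space \<Rightarrow> bool" where
  "crossing K p q \<longleftrightarrow> p \<in> K \<and> q \<in> K \<and> fst p = fst q \<and> snd q < snd p"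

definition undercrossings :: "space set \<Rightarrow> space set" where
  "undercrossings K = {q. \<exists>p. crossing K p q}"

text \<open>The arcs of the diagram run from one undercrossing to the next.  They are represented by the
  parts of \<open>K\<close> lying above them, without their end points.  If there is at least one crossing, there
  are as many arcs as crossings; the crossingless diagram consists of a single closed arc.\<close>

definition diagram_arcs :: "space set \<Rightarrow> space set set" where
  "diagram_arcs K = components (K - undercrossings K)"

definition arc_labelling :: "space set \<Rightarrow> nat \<Rightarrow> (nat \<Rightarrow> space set) \<Rightarrow> bool" where
  "arc_labelling K n lab \<longleftrightarrow> bij_betw lab {1..n} (diagram_arcs K)"

text \<open>The underarcs of a crossing are the arcs ending there.  They are distinct, i.e. \<open>j < k\<close>, except
  for a diagram with exactly one crossing, where \<open>i = j = k = 1\<close> is the only label.\<close>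

definition wirtinger_triples ::
    "space set \<Rightarrow> nat \<Rightarrow> (nat \<Rightarrow> space set) \<Rightarrow> (nat \<times> nat \<times> nat) set" where
  "wirtinger_triples K n lab =
     {(i, j, k). i \<in> {1..n} \<and> j \<le> k \<and>
        (\<exists>p q. crossing K p q \<and> p \<in> lab i \<and> {m \<in> {1..n}. q \<in> closure (lab m)} = {j, k})}"


section \<open>Commutative algebra\<close>

text \<open>A multivariate polynomial is a finitely supported function from monomials (finitely supported
  exponent functions) to coefficients; the library's multiplication on this type is convolution.\<close>

type_synonym ('v, 'a) mpoly = "('v \<Rightarrow>\<^sub>0 nat) \<Rightarrow>\<^sub>0 'a"

definition mpoly_ring :: "'v set \<Rightarrow> ('v, 'a::comm_ring_1) mpoly ring" where
  "mpoly_ring I = ring_of_type_algebra\<lparr>carrier := {p. \<forall>m \<in> Poly_Mapping.keys p. Poly_Mapping.keys m \<subseteq> I}\<rparr>"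

definition mpoly_const :: "'a::zero \<Rightarrow> ('v, 'a) mpoly" where
  "mpoly_const c = Poly_Mapping.single 0 c"

definition mpoly_var :: "'v \<Rightarrow> ('v, 'a::zero_neq_one) mpoly" where
  "mpoly_var v = Poly_Mapping.single (Poly_Mapping.single v 1) 1"

definition mpoly_eval :: "('v \<Rightarrow> 'a) \<Rightarrow> ('v, 'a::comm_semiring_1) mpoly \<Rightarrow> 'a" where
  "mpoly_eval x p = (\<Sum>m \<in> Poly_Mapping.keys p.
     Poly_Mapping.lookup p m * (\<Prod>v \<in> Poly_Mapping.keys m. x v ^ Poly_Mapping.lookup m v))"

definition nilradical :: "('a, 'm) ring_scheme \<Rightarrow> 'a set" where
  "nilradical R = {a \<in> carrier R. \<exists>k::nat. a [^]\<^bsub>R\<^esub> k = \<zero>\<^bsub>R\<^esub>}"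

text \<open>The tensor product over \<open>\<int>\<close> of two commutative rings: the free abelian group on
  \<open>A \<times> B\<close>, with the product \<open>(a, b) (a', b') = (a a', b b')\<close> extended bilinearly, modulo biadditivity.
  The subgroup generated by the biadditivity relations is an ideal, so the quotient by the ideal they
  generate is the usual one.\<close>

definition free_pair_ring ::
    "('a, 'm) ring_scheme \<Rightarrow> ('b, 'n) ring_scheme \<Rightarrow> (('a \<times> 'b) \<Rightarrow>\<^sub>0 int) ring" where
  "free_pair_ring A B =
     \<lparr>carrier = {f. Poly_Mapping.keys f \<subseteq> carrier A \<times> carrier B},
      mult = (\<lambda>f g. frag_extend (\<lambda>(a, b). frag_extend (\<lambda>(a', b').
                frag_of (a \<otimes>\<^bsub>A\<^esub> a', b \<otimes>\<^bsub>B\<^esub> b')) g) f),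
      one = frag_of (\<one>\<^bsub>A\<^esub>, \<one>\<^bsub>B\<^esub>), zero = 0, add = (+)\<rparr>"

definition biadditivity_relations ::
    "('a, 'm) ring_scheme \<Rightarrow> ('b, 'n) ring_scheme \<Rightarrow> (('a \<times> 'b) \<Rightarrow>\<^sub>0 int) set" where
  "biadditivity_relations A B =
     {frag_of (a \<oplus>\<^bsub>A\<^esub> a', b) - frag_of (a, b) - frag_of (a', b) | a a' b.
        a \<in> carrier A \<and> a' \<in> carrier A \<and> b \<in> carrier B} \<union>
     {frag_of (a, b \<oplus>\<^bsub>B\<^esub> b') - frag_of (a, b) - frag_of (a, b') | a b b'.
        a \<in> carrier A \<and> b \<in> carrier B \<and> b' \<in> carrier B}"

definition tensor_ring ::
    "('a, 'm) ring_scheme \<Rightarrow> ('b, 'n) ring_scheme \<Rightarrow> (('a \<times> 'b) \<Rightarrow>\<^sub>0 int) set ring" where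
  "tensor_ring A B =
     free_pair_ring A B Quot (Idl\<^bsub>free_pair_ring A B\<^esub> (biadditivity_relations A B))"

text \<open>For \<open>V \<subseteq> \<complex>\<^sup>I\<close>, where points of \<open>\<complex>\<^sup>I\<close> are the elements of \<open>I \<rightarrow>\<^sub>E UNIV\<close>.\<close>

definition vanishing_ideal :: "'v set \<Rightarrow> ('v \<Rightarrow> complex) set \<Rightarrow> ('v, complex) mpoly set" where
  "vanishing_ideal I V = {p \<in> carrier (mpoly_ring I). \<forall>x \<in> V. mpoly_eval x p = 0}"

definition coordinate_ring :: "'v set \<Rightarrow> ('v \<Rightarrow> complex) set \<Rightarrow> ('v, complex) mpoly set ring" where
  "coordinate_ring I V = mpoly_ring I Quot vanishing_ideal I V"


section \<open>Abelian knot contact homology and the fundamental variety\<close>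

definition label_pairs :: "nat \<Rightarrow> (nat \<times> nat) set" where
  "label_pairs n = {(i, j). 1 \<le> i \<and> i < j \<and> j \<le> n}"

text \<open>Extends a family indexed by pairs \<open>i < j\<close> symmetrically to all pairs, with value \<open>d\<close> on the
  diagonal.\<close>

definition sym_ext :: "'a \<Rightarrow> (nat \<times> nat \<Rightarrow> 'a) \<Rightarrow> nat \<Rightarrow> nat \<Rightarrow> 'a" where
  "sym_ext d f i j = (if i = j then d else f (min i j, max i j))"

definition contact_gen :: "nat \<Rightarrow> nat \<Rightarrow> (nat \<times> nat, int) mpoly" where
  "contact_gen = sym_ext (mpoly_const (- 2)) mpoly_var"

definition contact_relations ::
    "nat \<Rightarrow> (nat \<times> nat \<times> nat) set \<Rightarrow> (nat \<times> nat, int) mpoly set" where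
  "contact_relations n W =
     {contact_gen l j + contact_gen l k + contact_gen l i * contact_gen i j | l i j k.
        (i, j, k) \<in> W \<and> l \<in> {1..n}}"

definition HC0_ab ::
    "space set \<Rightarrow> nat \<Rightarrow> (nat \<Rightarrow> space set) \<Rightarrow> (nat \<times> nat, int) mpoly set ring" where
  "HC0_ab K n lab =
     (let R = mpoly_ring (label_pairs n)
      in R Quot (Idl\<^bsub>R\<^esub> (contact_relations n (wirtinger_triples K n lab))))"

definition fundamental_variety ::
    "space set \<Rightarrow> nat \<Rightarrow> (nat \<Rightarrow> space set) \<Rightarrow> (nat \<times> nat \<Rightarrow> complex) set" where
  "fundamental_variety K n lab =
     {x \<in> label_pairs n \<rightarrow>\<^sub>E UNIV.
        \<forall>(i, j, k) \<in> wirtinger_triples K n lab. \<forall>a \<in> {1..n}.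
          sym_ext 2 x a k - sym_ext 2 x i j * sym_ext 2 x a i + sym_ext 2 x a j = 0}"

end

theory Submission
  imports Defs
begin

text \<open>
  The relations of \<open>HC\<^sub>0\<^sup>a\<^sup>b\<close> become, up to sign, the equations of \<open>F\<^sub>2\<close> under \<open>x\<^sub>i\<^sub>j = - a\<^sub>i\<^sub>j\<close>. For an ideal \<open>J\<close> of \<open>\<int>[X]\<close>
  generated by \<open>S\<close>, extension of scalars gives \<open>(\<int>[X]/J) \<otimes> \<complex> \<cong> \<complex>[X]/(S)\<close>, and the Nullstellensatz
  identifies the nilradical of the latter with the functions vanishing on the zeros of \<open>S\<close>.

  The Nullstellensatz is proved by a cardinality argument. Take an ideal \<open>P\<close> that contains \<open>S\<close> and is
  maximal among those avoiding the powers of \<open>p\<close>. Since \<open>\<complex>\<close> is uncountable and \<open>\<complex>[X]\<close> has countable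
  dimension, every variable is congruent to a constant modulo \<open>P\<close>, so \<open>P\<close> defines a zero of \<open>S\<close> at
  which \<open>p\<close> does not vanish.
\<close>

text \<open>Complex polynomial ideals are handled as submodules of the polynomial type over itself,
  which is what the interpretation \<open>mult_module\<close> is for. This type contains all
  variables of \<open>'v\<close>, whereas the rings of the statement use only the variables in a set
  \<open>I\<close>; the difference is bridged by restricting points to \<open>I\<close> and by
  discarding monomials that involve other variables. The ring \<complex>[X]/(S) is never formed. An
  element of the tensor product is a class of formal sums of pairs (coset, scalar), so a map to
  polynomials must choose representatives of the cosets and respects the ring operations only modulo
  (S). The ambiguity disappears on the zero set of S, so passing to the coordinate ring gives a
  genuine homomorphism. Its kernel is where the exact comparison of ideals is needed: a power of a
  polynomial lying in (S) must make a power of the tensor zero.\<close>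

interpretation mult_module: Modules.module "(*) :: 'a::comm_ring_1 \<Rightarrow> 'a \<Rightarrow> 'a"
  by unfold_locales (simp_all add: algebra_simps)

text \<open>As a rewrite rule, \<open>scale_scale\<close> is reverse associativity here; it makes \<open>algebra_simps\<close> loop.\<close>

declare mult_module.scale_scale [simp del]

section \<open>Polynomial evaluation\<close>

text \<open>Point masses generate additively. Identities between products that are additive in each
  factor thus need checking on two monomials only. The rule also serves for the monomials
  themselves, with exponents as values.\<close>

lemma poly_mapping_additive_induct [case_names zero single add]:
  assumes "P 0" and "\<And>m c. P (Poly_Mapping.single m c)"
    and "\<And>p q. P p \<Longrightarrow> P q \<Longrightarrow> P (p + q)"
  shows "P (p :: 'b \<Rightarrow>\<^sub>0 'a::comm_monoid_add)"
proof (induction p rule: update_induct)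
  case const
  then show ?case by (rule assms(1))
next
  case (update f a b)
  have "Poly_Mapping.update a b f = f + Poly_Mapping.single a b"
    using update(1)
    by (intro poly_mapping_eqI)
      (auto simp: lookup_update lookup_add lookup_single when_def in_keys_iff)
  then show ?case using assms update by simp
qed

definition monom_eval :: "('v \<Rightarrow> 'a::comm_semiring_1) \<Rightarrow> ('v \<Rightarrow>\<^sub>0 nat) \<Rightarrow> 'a" where
  "monom_eval x m = (\<Prod>v \<in> Poly_Mapping.keys m. x v ^ Poly_Mapping.lookup m v)"

text \<open>The support of a sum depends on cancellation, so additivity is proved over a common
  finite superset of the supports. The same device recurs for \<open>mpoly_eval\<close>,
  \<open>frag_lift\<close> and \<open>\<sigma>\<close>.\<close>

lemma monom_eval_superset:
  assumes "finite A" "Poly_Mapping.keys m \<subseteq> A"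
  shows "monom_eval x m = (\<Prod>v \<in> A. x v ^ Poly_Mapping.lookup m v)"
  unfolding monom_eval_def
  by (rule prod.mono_neutral_left) (use assms in \<open>auto simp: in_keys_iff\<close>)

lemma monom_eval_zero [simp]: "monom_eval x 0 = 1"
  by (simp add: monom_eval_def)

lemma monom_eval_add: "monom_eval x (m + m') = monom_eval x m * monom_eval x m'"
proof -
  let ?A = "Poly_Mapping.keys m \<union> Poly_Mapping.keys m'"
  have "monom_eval x (m + m') = (\<Prod>v \<in> ?A. x v ^ Poly_Mapping.lookup (m + m') v)"
    by (rule monom_eval_superset) (use keys_add[of m m'] in auto)
  also have "\<dots> = monom_eval x m * monom_eval x m'"
    by (subst (1 2) monom_eval_superset[of ?A])
       (auto simp: lookup_add power_add prod.distrib)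
  finally show ?thesis .
qed

lemma monom_eval_mult: "monom_eval (\<lambda>v. x v * y v) m = monom_eval x m * monom_eval y m"
  by (simp add: monom_eval_def power_mult_distrib prod.distrib)

lemma monom_eval_cong:
  "(\<And>v. v \<in> Poly_Mapping.keys m \<Longrightarrow> x v = y v) \<Longrightarrow> monom_eval x m = monom_eval y m"
  by (simp add: monom_eval_def)

lemma mpoly_eval_alt:
  "mpoly_eval x p = (\<Sum>m \<in> Poly_Mapping.keys p. Poly_Mapping.lookup p m * monom_eval x m)"
  by (simp add: mpoly_eval_def monom_eval_def)

lemma mpoly_eval_superset:
  assumes "finite A" "Poly_Mapping.keys p \<subseteq> A"
  shows "mpoly_eval x p = (\<Sum>m \<in> A. Poly_Mapping.lookup p m * monom_eval x m)"
  unfolding mpoly_eval_alt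
  by (rule sum.mono_neutral_left) (use assms in \<open>auto simp: in_keys_iff\<close>)

lemma mpoly_eval_zero [simp]: "mpoly_eval x 0 = 0"
  by (simp add: mpoly_eval_def)

lemma mpoly_eval_single [simp]:
  "mpoly_eval x (Poly_Mapping.single m c) = c * monom_eval x m"
  by (cases "c = 0") (simp_all add: mpoly_eval_alt)

lemma mpoly_eval_one [simp]: "mpoly_eval x 1 = 1"
  using mpoly_eval_single[of x 0 1] by simp

lemma mpoly_eval_add: "mpoly_eval x (p + q) = mpoly_eval x p + mpoly_eval x q"
proof -
  let ?A = "Poly_Mapping.keys p \<union> Poly_Mapping.keys q"
  have "mpoly_eval x (p + q) = (\<Sum>m \<in> ?A. Poly_Mapping.lookup (p + q) m * monom_eval x m)"
    by (rule mpoly_eval_superset) (use keys_add[of p q] in auto)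
  also have "\<dots> = mpoly_eval x p + mpoly_eval x q"
    by (subst (1 2) mpoly_eval_superset[of ?A])
       (auto simp: lookup_add distrib_right sum.distrib)
  finally show ?thesis .
qed

lemma mpoly_eval_mult: "mpoly_eval x (p * q) = mpoly_eval x p * mpoly_eval x q"
proof (induction p rule: poly_mapping_additive_induct)
  case (single m c)
  show ?case
    by (induction q rule: poly_mapping_additive_induct)
       (simp_all add: mpoly_eval_add mult_single monom_eval_add algebra_simps)
qed (simp_all add: mpoly_eval_add algebra_simps)

lemma mpoly_eval_uminus:
  fixes p :: "('v, 'a::comm_ring_1) mpoly"
  shows "mpoly_eval x (- p) = - mpoly_eval x p"
  using mpoly_eval_add[of x p "- p"] by (simp add: add_eq_0_iff)

lemma mpoly_eval_diff:
  fixes p :: "('v, 'a::comm_ring_1) mpoly"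
  shows "mpoly_eval x (p - q) = mpoly_eval x p - mpoly_eval x q"
  using mpoly_eval_add[of x p "- q"] by (simp add: mpoly_eval_uminus)

lemma mpoly_eval_power: "mpoly_eval x (p ^ k) = mpoly_eval x p ^ k"
  by (induction k) (simp_all add: mpoly_eval_mult)

lemma mpoly_eval_cong:
  assumes "\<And>m v. m \<in> Poly_Mapping.keys p \<Longrightarrow> v \<in> Poly_Mapping.keys m \<Longrightarrow> x v = y v"
  shows "mpoly_eval x p = mpoly_eval y p"
  unfolding mpoly_eval_alt
  by (intro sum.cong refl arg_cong2[of _ _ _ _ "(*)"] monom_eval_cong) (use assms in auto)

lemma mpoly_eval_span:
  fixes s :: "('v, 'a::comm_ring_1) mpoly"
  assumes "q \<in> mult_module.span S" "\<And>s. s \<in> S \<Longrightarrow> mpoly_eval x s = 0"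
  shows "mpoly_eval x q = 0"
  using assms(1)
  by (induction rule: mult_module.span_induct_alt)
     (auto simp: mpoly_eval_add mpoly_eval_mult assms(2))

section \<open>Constant polynomials\<close>

lemma mpoly_const_add: "mpoly_const (a + b) = mpoly_const a + mpoly_const b"
  by (simp add: mpoly_const_def single_add)

lemma mpoly_const_diff:
  fixes a :: "'a::ab_group_add"
  shows "mpoly_const (a - b) = mpoly_const a - mpoly_const b"
  by (simp add: mpoly_const_def single_diff)

lemma mpoly_const_mult: "mpoly_const (a * b) = mpoly_const a * mpoly_const b"
  for a :: "'a::comm_semiring_1"
  by (simp add: mpoly_const_def mult_single)

lemma mpoly_const_zero [simp]: "mpoly_const 0 = 0"
  and mpoly_const_one [simp]: "mpoly_const 1 = 1"
  by (simp_all add: mpoly_const_def)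

lemma mpoly_const_times_single:
  "mpoly_const (a :: 'a::comm_semiring_1) * Poly_Mapping.single m b = Poly_Mapping.single m (a * b)"
  by (simp add: mpoly_const_def mult_single)

lemma lookup_mpoly_const_times:
  fixes a :: "'a::comm_semiring_1"
  shows "Poly_Mapping.lookup (mpoly_const a * p) m = a * Poly_Mapping.lookup p m"
proof (induction p rule: poly_mapping_additive_induct)
  case (single n c)
  show ?case by (auto simp: mpoly_const_times_single lookup_single when_def)
qed (simp_all add: lookup_add distrib_left)

section \<open>Hilbert's Nullstellensatz\<close>

text \<open>Gaussian elimination, with equations indexed by \<open>F\<close> and unknowns by
  \<open>C\<close>: an equation with a nonzero coefficient is solved for that unknown, which removes
  one equation and one unknown.\<close>

lemma homogeneous_system_nontrivial_solution:
  fixes G :: "'c \<Rightarrow> 'm \<Rightarrow> 'a::field"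
  assumes "finite F" "finite C" "card F < card C"
  shows "\<exists>l. (\<exists>c\<in>C. l c \<noteq> 0) \<and> (\<forall>m\<in>F. (\<Sum>c\<in>C. l c * G c m) = 0)"
  using assms
proof (induction F arbitrary: C G rule: finite_induct)
  case empty
  then obtain c where "c \<in> C" by fastforce
  then show ?case by (intro exI[of _ "\<lambda>_. 1"]) auto
next
  case (insert m F)
  show ?case
  proof (cases "\<forall>c\<in>C. G c m = 0")
    case True
    have "card F < card C" using insert.prems insert.hyps by simp
    then obtain l where "\<exists>c\<in>C. l c \<noteq> 0" "\<forall>m\<in>F. (\<Sum>c\<in>C. l c * G c m) = 0"
      using insert.IH[OF insert.prems(1)] by blast
    then show ?thesis using True by (intro exI[of _ l]) simp
  next
    case False
    then obtain d where d: "d \<in> C" "G d m \<noteq> 0" by blast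
    \<comment> \<open>The multiple of equation \<open>m\<close> that clears the unknown
      \<open>d\<close> is subtracted from each equation \<open>k\<close>.\<close>
    define G' where "G' c k = G c k - G c m * (G d k / G d m)" for c k
    have "finite (C - {d})" "card F < card (C - {d})"
      using insert.prems insert.hyps d by (simp_all add: card_Diff_singleton)
    from insert.IH[OF this, of G'] obtain l where l: "\<exists>c\<in>C - {d}. l c \<noteq> 0"
      "\<forall>k\<in>F. (\<Sum>c\<in>C - {d}. l c * G' c k) = 0"
      by blast
    define a where "a = (\<Sum>c\<in>C - {d}. l c * G c m)"
    \<comment> \<open>The value at \<open>d\<close> is the one that equation \<open>m\<close>
      forces.\<close>
    define l' where "l' = l(d := - a / G d m)"
    have sum_l': "(\<Sum>c\<in>C. l' c * G c k) = (\<Sum>c\<in>C - {d}. l c * G' c k)" for k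
    proof -
      have "(\<Sum>c\<in>C. l' c * G c k) = (\<Sum>c\<in>C - {d}. l c * G c k) - a * (G d k / G d m)"
        using insert.prems d by (simp add: sum.remove[of C d] l'_def)
      also have "\<dots> = (\<Sum>c\<in>C - {d}. l c * G' c k)"
        by (simp add: a_def sum_distrib_right sum_divide_distrib G'_def right_diff_distrib sum_subtractf
            mult.assoc)
      finally show ?thesis .
    qed
    moreover have "G' c m = 0" for c
      using d by (simp add: G'_def)
    ultimately have "\<forall>k\<in>insert m F. (\<Sum>c\<in>C. l' c * G c k) = 0"
      using l(2) by simp
    moreover have "\<exists>c\<in>C. l' c \<noteq> 0"
      using l(1) by (auto simp: l'_def)
    ultimately show ?thesis by blast
  qed
qed

section \<open>Countability\<close>

lemma uncountable_fibre:
  assumes "uncountable A" "countable (f ` A)"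
  shows "\<exists>y. uncountable {a \<in> A. f a = y}"
proof (rule ccontr)
  assume "\<not> ?thesis"
  then have "countable (\<Union>y\<in>f ` A. {a \<in> A. f a = y})"
    using assms(2) by (intro countable_UN) auto
  moreover have "(\<Union>y\<in>f ` A. {a \<in> A. f a = y}) = A" by auto
  ultimately show False using assms(1) by simp
qed

lemma countable_finite_sets:
  assumes "countable (UNIV :: 'a set)"
  shows "countable {F :: 'a set. finite F}"
  using countable_Collect_finite_subset[OF assms] by simp

text \<open>A monomial is determined by the graph of its exponents on the support, a finite subset
  of the countable type \<open>'v \<times> nat\<close>.\<close>

lemma countable_monomials: "countable (UNIV :: ('v::countable \<Rightarrow>\<^sub>0 nat) set)"
proof -
  define f :: "('v \<Rightarrow>\<^sub>0 nat) \<Rightarrow> ('v \<times> nat) set"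
    where "f m = (\<lambda>v. (v, Poly_Mapping.lookup m v)) ` Poly_Mapping.keys m" for m
  have mem: "(v, k) \<in> f m \<longleftrightarrow> Poly_Mapping.lookup m v = k \<and> k \<noteq> 0" for v k m
    by (auto simp: f_def in_keys_iff)
  have "inj f"
  proof (rule injI, rule poly_mapping_eqI)
    fix m m' v assume "f m = f m'"
    then show "Poly_Mapping.lookup m v = Poly_Mapping.lookup m' v"
      using mem[of v _ m] mem[of v _ m'] by metis
  qed
  moreover have "range f \<subseteq> {F. finite F}"
    unfolding f_def using finite_keys by blast
  then have "countable (range f)"
    by (rule countable_subset[OF _ countable_Collect_finite])
  ultimately show ?thesis
    by (rule countable_image_inj_on[rotated])
qed

section \<open>Univariate polynomials evaluated at a multivariate one\<close>

definition poly_at :: "('v, 'a::comm_ring_1) mpoly \<Rightarrow> 'a poly \<Rightarrow> ('v, 'a) mpoly" where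
  "poly_at Y h = poly (map_poly mpoly_const h) Y"

lemma poly_at_zero [simp]: "poly_at Y 0 = 0"
  by (simp add: poly_at_def)

lemma poly_at_pCons [simp]: "poly_at Y (pCons a h) = mpoly_const a + Y * poly_at Y h"
  by (simp add: poly_at_def map_poly_pCons)

lemma poly_at_one [simp]: "poly_at Y 1 = 1"
  unfolding one_pCons by simp

lemma poly_at_add: "poly_at Y (p + q) = poly_at Y p + poly_at Y q"
  by (induction p q rule: poly_induct2) (simp_all add: mpoly_const_add algebra_simps)

lemma poly_at_smult: "poly_at Y (Polynomial.smult c p) = mpoly_const c * poly_at Y p"
  by (induction p) (simp_all add: mpoly_const_mult distrib_left mult.left_commute)

lemma poly_at_sum: "poly_at Y (sum f A) = (\<Sum>a\<in>A. poly_at Y (f a))"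
  by (induction A rule: infinite_finite_induct) (simp_all add: poly_at_add)

text \<open>This case of multiplicativity suffices, since over an algebraically closed field
  polynomials are taken apart into linear factors.\<close>

lemma poly_at_linear_times: "poly_at Y ([:- c, 1:] * h) = (Y - mpoly_const c) * poly_at Y h"
proof -
  have "[:- c, 1:] * h = Polynomial.smult (- c) h + pCons 0 h"
    by simp
  then have "poly_at Y ([:- c, 1:] * h) = mpoly_const (0 - c) * poly_at Y h + Y * poly_at Y h"
    by (simp only: poly_at_add poly_at_smult poly_at_pCons mpoly_const_zero add_0 diff_0)
  also have "\<dots> = (Y - mpoly_const c) * poly_at Y h"
    unfolding mpoly_const_diff by (simp add: left_diff_distrib)
  finally show ?thesis .
qed

lemma poly_at_prod_linear:
  "poly_at Y (\<Prod>c\<in>C. [:- c, 1:]) = (\<Prod>c\<in>C. Y - mpoly_const c)"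
proof (induction C rule: infinite_finite_induct)
  case (insert c C)
  then show ?case by (simp only: prod.insert[OF insert.hyps] poly_at_linear_times)
qed simp_all

text \<open>The exclusion of the powers of \<open>p\<close> replaces localisation (the Rabinowitsch trick).\<close>

locale maximal_avoiding =
  fixes P :: "'a::comm_ring_1 set" and p :: 'a
  assumes ideal: "mult_module.subspace P"
    and avoids: "p ^ k \<notin> P"
    and maximal: "mult_module.subspace Q \<Longrightarrow> P \<subseteq> Q \<Longrightarrow> (\<And>k. p ^ k \<notin> Q) \<Longrightarrow> Q = P"
begin

lemma one_notin: "1 \<notin> P"
  using avoids[of 0] by simp

lemma mult_in: "a \<in> P \<Longrightarrow> b * a \<in> P"
  by (rule mult_module.subspace_scale[OF ideal])

lemma unit_notin: "b * a = 1 \<Longrightarrow> a \<notin> P"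
  using mult_in one_notin by metis

text \<open>By maximality, the ideal generated by \<open>P\<close> and \<open>a\<close> contains a
  power of \<open>p\<close>. So every element outside \<open>P\<close> divides a power of
  \<open>p\<close> modulo \<open>P\<close>; after inverting \<open>p\<close>, the quotient would be
  a field.\<close>

lemma power_in_adjoin:
  assumes "a \<notin> P"
  shows "\<exists>k g. p ^ k - g * a \<in> P"
proof -
  let ?Q = "mult_module.span (insert a P)"
  have span_P: "mult_module.span P = P"
    using ideal by (simp add: mult_module.span_eq_iff)
  have "P \<subseteq> ?Q" "a \<in> ?Q"
    using mult_module.span_superset[of "insert a P"] by auto
  then have "\<exists>k. p ^ k \<in> ?Q"
    using maximal[of ?Q] assms by auto
  then show ?thesis
    by (auto simp: mult_module.span_insert span_P)
qed

text \<open>Multiplying the congruences of \<open>p ^ i\<close> with \<open>g * a\<close> and of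
  \<open>p ^ j\<close> with \<open>h * b\<close> modulo \<open>P\<close> would put
  \<open>p ^ (i + j)\<close> into \<open>P\<close>.\<close>

lemma prime:
  assumes "a * b \<in> P" "a \<notin> P" "b \<notin> P"
  shows False
proof -
  obtain i g where g: "p ^ i - g * a \<in> P"
    using power_in_adjoin[OF assms(2)] by metis
  obtain j h where h: "p ^ j - h * b \<in> P"
    using power_in_adjoin[OF assms(3)] by metis
  have "p ^ j * (p ^ i - g * a) + g * a * (p ^ j - h * b) + (g * h) * (a * b) = p ^ (i + j)"
    by (simp add: power_add right_diff_distrib mult.commute mult.left_commute)
  moreover have "p ^ j * (p ^ i - g * a) + g * a * (p ^ j - h * b) + (g * h) * (a * b) \<in> P"
    by (intro mult_module.subspace_add[OF ideal] mult_in[OF g] mult_in[OF h] mult_in[OF assms(1)])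
  ultimately show False using avoids[of "i + j"] by simp
qed

end

text \<open>Zorn's lemma applies: two elements of the union of a chain lie in a common member, so
  the union is an ideal, and a power of \<open>p\<close> in the union would lie in some
  member.\<close>

lemma maximal_avoiding_exists:
  fixes p :: "'a::comm_ring_1"
  assumes "\<And>k. p ^ k \<notin> mult_module.span S"
  shows "\<exists>P. S \<subseteq> P \<and> maximal_avoiding P p"
proof -
  define \<A> where "\<A> = {Q. mult_module.subspace Q \<and> S \<subseteq> Q \<and> (\<forall>k. p ^ k \<notin> Q)}"
  have "mult_module.span S \<in> \<A>"
    using assms mult_module.span_superset[of S] by (auto simp: \<A>_def)
  moreover have "\<Union>\<C> \<in> \<A>" if ne: "\<C> \<noteq> {}" and ch: "subset.chain \<A> \<C>" for \<C>
  proof -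
    have sub: "Q \<in> \<A>" if "Q \<in> \<C>" for Q
      using ch that by (auto simp: subset.chain_def)
    have lin: "Q \<subseteq> Q' \<or> Q' \<subseteq> Q" if "Q \<in> \<C>" "Q' \<in> \<C>" for Q Q'
      using ch that unfolding subset_chain_def by blast
    have "mult_module.subspace (\<Union>\<C>)"
      unfolding mult_module.subspace_def
    proof (intro conjI ballI allI)
      show "0 \<in> \<Union>\<C>"
        using ne sub mult_module.subspace_0 unfolding \<A>_def by blast
      show "x + y \<in> \<Union>\<C>" if "x \<in> \<Union>\<C>" "y \<in> \<Union>\<C>" for x y
      proof -
        from that lin obtain Q where "Q \<in> \<C>" "x \<in> Q" "y \<in> Q" by blast
        then show ?thesis
          using sub mult_module.subspace_add[of Q x y] by (auto simp: \<A>_def)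
      qed
      show "c * x \<in> \<Union>\<C>" if "x \<in> \<Union>\<C>" for c x
      proof -
        from that obtain Q where "Q \<in> \<C>" "x \<in> Q" by blast
        then show ?thesis
          using sub mult_module.subspace_scale[of Q x c] by (auto simp: \<A>_def)
      qed
    qed
    then show ?thesis using ne sub by (auto simp: \<A>_def)
  qed
  ultimately have "\<exists>P\<in>\<A>. \<forall>Q\<in>\<A>. P \<subseteq> Q \<longrightarrow> Q = P"
    by (intro subset_Zorn_nonempty) auto
  then obtain P where P: "P \<in> \<A>" "\<forall>Q\<in>\<A>. P \<subseteq> Q \<longrightarrow> Q = P"
    by blast
  have max: "maximal_avoiding P p"
  proof
    show "Q = P" if "mult_module.subspace Q" "P \<subseteq> Q" "\<And>k. p ^ k \<notin> Q" for Q
    proof -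
      have "Q \<in> \<A>" using that P(1) by (auto simp: \<A>_def)
      then show ?thesis using P(2) that(2) by blast
    qed
  qed (use P(1) in \<open>auto simp: \<A>_def\<close>)
  have "S \<subseteq> P" using P(1) by (simp add: \<A>_def)
  show ?thesis
    by (rule exI, rule conjI) fact+
qed

text \<open>If no \<open>Y - c\<close> lay in \<open>P\<close>, then the uncountably many inverses of the \<open>Y - c\<close> modulo \<open>P\<close>
  would be linearly dependent, since there are only countably many monomials. Clearing denominators in
  a dependency gives an algebraic equation for \<open>Y\<close>, which splits into linear factors.\<close>

lemma residue_of_variable:
  fixes P :: "('v::countable, 'a::alg_closed_field) mpoly set"
  assumes "maximal_avoiding P p" and uncountable: "uncountable (UNIV :: 'a set)"
  shows "\<exists>c. Y - mpoly_const c \<in> P"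
proof (rule ccontr)
  interpret maximal_avoiding P p by fact
  assume "\<not> ?thesis"
  then have Y: "Y - mpoly_const c \<notin> P" for c by blast
  \<comment> \<open>Induction on the degree: a nonzero constant is a unit, and otherwise a linear
    factor \<open>Y - c\<close> splits off, which is outside the prime ideal
    \<open>P\<close>.\<close>
  have poly_at_notin: "poly_at Y h \<notin> P" if "h \<noteq> 0" for h
    using that
  proof (induction "Polynomial.degree h" arbitrary: h)
    case 0
    then obtain c where h: "h = [:c:]" "c \<noteq> 0"
      by (metis degree_eq_zeroE pCons_0_0)
    have "mpoly_const (inverse c) * mpoly_const c = (1 :: ('v, 'a) mpoly)"
      using h by (simp flip: mpoly_const_mult)
    from unit_notin[OF this] show ?case using h by simp
  next
    case (Suc n)
    obtain c where "poly h c = 0"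
      using alg_closed_imp_poly_has_root[of h] Suc.hyps by auto
    then obtain h' where h': "h = [:- c, 1:] * h'"
      by (auto simp: poly_eq_0_iff_dvd)
    then have "h' \<noteq> 0" using Suc.prems by auto
    then have "Polynomial.degree h = Suc (Polynomial.degree h')"
      unfolding h' by (subst degree_mult_eq) auto
    then have "poly_at Y h' \<notin> P" using Suc.hyps \<open>h' \<noteq> 0\<close> by auto
    then show ?case
      unfolding h' poly_at_linear_times using prime[OF _ Y[of c]] by blast
  qed
  \<comment> \<open>After inverting \<open>p\<close>, the fraction \<open>g c / p ^ k c\<close> is
    the inverse of \<open>Y - c\<close> modulo \<open>P\<close>.\<close>
  obtain k g where kg: "p ^ k c - g c * (Y - mpoly_const c) \<in> P" for c
  proof -
    have "\<forall>c. \<exists>k g. p ^ k - g * (Y - mpoly_const c) \<in> P"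
      using power_in_adjoin[OF Y] by blast
    then show ?thesis using that by metis
  qed
  \<comment> \<open>Exponents and supports together take only countably many values, so uncountably
    many \<open>c\<close> share both. Their \<open>g c\<close> then lie in a space of finite
    dimension \<open>card F\<close>, with a common denominator \<open>p ^ i\<close>.\<close>
  have "countable (range (\<lambda>c. (k c, Poly_Mapping.keys (g c))))"
    by (rule countable_subset[of _ "UNIV \<times> {F. finite F}"])
       (auto intro: countable_SIGMA countable_finite_sets countable_monomials)
  from uncountable_fibre[OF uncountable this]
  obtain i F where "uncountable {c. k c = i \<and> Poly_Mapping.keys (g c) = F}" by auto
  then have "infinite {c. k c = i \<and> Poly_Mapping.keys (g c) = F}"
    using countable_finite by blast
  \<comment> \<open>One more polynomial than there are monomials in \<open>F\<close> forces a linear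
    dependence.\<close>
  from infinite_arbitrarily_large[OF this, of "Suc (card F)"]
  obtain C where C: "finite C" "card C = Suc (card F)"
    and "C \<subseteq> {c. k c = i \<and> Poly_Mapping.keys (g c) = F}"
    by blast
  then have g: "k c = i" "Poly_Mapping.keys (g c) = F" if "c \<in> C" for c
    using that by auto
  obtain c\<^sub>0 where "c\<^sub>0 \<in> C" using C by fastforce
  then have "finite F" using g(2) finite_keys by metis
  then have "\<exists>l. (\<exists>c\<in>C. l c \<noteq> 0) \<and>
      (\<forall>m\<in>F. (\<Sum>c\<in>C. l c * Poly_Mapping.lookup (g c) m) = 0)"
    by (rule homogeneous_system_nontrivial_solution) (use C in simp_all)
  then obtain l where l: "\<exists>c\<in>C. l c \<noteq> 0"
    "\<And>m. m \<in> F \<Longrightarrow> (\<Sum>c\<in>C. l c * Poly_Mapping.lookup (g c) m) = 0"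
    by blast
  have dependency: "(\<Sum>c\<in>C. mpoly_const (l c) * g c) = 0"
  proof (rule poly_mapping_eqI)
    fix m
    have "(\<Sum>c\<in>C. l c * Poly_Mapping.lookup (g c) m) = 0"
    proof (cases "m \<in> F")
      case False
      then have "Poly_Mapping.lookup (g c) m = 0" if "c \<in> C" for c
        using g(2)[OF that] by (auto simp: in_keys_iff)
      then show ?thesis by simp
    qed (rule l)
    then show "Poly_Mapping.lookup (\<Sum>c\<in>C. mpoly_const (l c) * g c) m = Poly_Mapping.lookup 0 m"
      by (simp add: lookup_sum lookup_mpoly_const_times)
  qed
  \<comment> \<open>The numerator of the sum of the fractions \<open>l c / (Y - c)\<close> over
    their common denominator.\<close>
  define h where "h = (\<Sum>c\<in>C. Polynomial.smult (l c) (\<Prod>d\<in>C - {c}. [:- d, 1:]))"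
  define \<pi> where "\<pi> c = (\<Prod>d\<in>C - {c}. Y - mpoly_const d)" for c
  have "h \<noteq> 0"
  proof
    assume "h = 0"
    from l(1) obtain c where c: "c \<in> C" "l c \<noteq> 0" by blast
    \<comment> \<open>As in Lagrange interpolation, evaluation at \<open>c\<close> leaves only the
      summand of \<open>c\<close>, which is \<open>l c\<close> times a product of nonzero
      differences.\<close>
    have "poly h c = (\<Sum>d\<in>C. l d * (\<Prod>e\<in>C - {d}. c - e))"
      by (simp add: h_def poly_sum poly_prod)
    also have "\<dots> = (\<Sum>d\<in>C. if d = c then l c * (\<Prod>e\<in>C - {c}. c - e) else 0)"
    proof (rule sum.cong)
      fix d assume "d \<in> C"
      show "l d * (\<Prod>e\<in>C - {d}. c - e) = (if d = c then l c * (\<Prod>e\<in>C - {c}. c - e) else 0)"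
      proof (cases "d = c")
        case False
        then have "(\<Prod>e\<in>C - {d}. c - e) = 0"
          using C(1) c by (intro prod_zero) auto
        then show ?thesis using False by simp
      qed simp
    qed simp
    also have "\<dots> = l c * (\<Prod>e\<in>C - {c}. c - e)"
      using C(1) c by simp
    also have "\<dots> \<noteq> 0" using C(1) c by auto
    finally show False using \<open>h = 0\<close> by simp
  qed
  have prod_C: "(Y - mpoly_const c) * \<pi> c = (\<Prod>d\<in>C. Y - mpoly_const d)" if "c \<in> C" for c
    using that C(1) by (simp add: \<pi>_def prod.remove)
  \<comment> \<open>Modulo \<open>P\<close>, each \<open>p ^ i\<close> may be replaced by
    \<open>g c * (Y - mpoly_const c)\<close>. This completes \<open>\<pi> c\<close> to the product
    over all of \<open>C\<close>, which factors out and leaves the vanishing sum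
    \<open>dependency\<close>.\<close>
  have "p ^ i * poly_at Y h = (\<Sum>c\<in>C. mpoly_const (l c) * (p ^ i * \<pi> c))"
    unfolding h_def poly_at_sum \<pi>_def sum_distrib_left
    by (rule sum.cong[OF refl], subst poly_at_smult, subst poly_at_prod_linear, rule mult.left_commute)
  also have "\<dots> = (\<Sum>c\<in>C. mpoly_const (l c) * \<pi> c * (p ^ k c - g c * (Y - mpoly_const c)))
      + (\<Sum>c\<in>C. mpoly_const (l c) * g c) * (\<Prod>d\<in>C. Y - mpoly_const d)"
  proof -
    have "mpoly_const (l c) * (p ^ i * \<pi> c) =
        mpoly_const (l c) * \<pi> c * (p ^ k c - g c * (Y - mpoly_const c))
        + mpoly_const (l c) * g c * (\<Prod>d\<in>C. Y - mpoly_const d)" if "c \<in> C" for c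
    proof -
      have "x * (y * z) = x * z * (y - u * v) + x * u * (v * z)" for x y z u v :: "('v, 'a) mpoly"
        by (simp add: right_diff_distrib mult.commute mult.left_commute)
      then show ?thesis
        unfolding prod_C[OF that, symmetric] g(1)[OF that] .
    qed
    then show ?thesis
      unfolding sum_distrib_right sum.distrib[symmetric] by (rule sum.cong[OF refl])
  qed
  also have "\<dots> \<in> P"
    unfolding dependency mult_zero_left add_0_right
    by (intro mult_module.subspace_sum[OF ideal] mult_in kg)
  finally show False
    using prime[OF _ avoids poly_at_notin[OF \<open>h \<noteq> 0\<close>]] by blast
qed

theorem nullstellensatz:
  fixes p :: "('v::countable, 'a::alg_closed_field) mpoly"
  assumes "uncountable (UNIV :: 'a set)"
    and vanishing: "\<And>x. (\<And>s. s \<in> S \<Longrightarrow> mpoly_eval x s = 0) \<Longrightarrow> mpoly_eval x p = 0"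
  shows "\<exists>k. p ^ k \<in> mult_module.span S"
proof (rule ccontr)
  assume "\<not> ?thesis"
  then obtain P where "S \<subseteq> P" and P: "maximal_avoiding P p"
    using maximal_avoiding_exists by blast
  interpret maximal_avoiding P p by fact
  have "\<forall>v. \<exists>c. mpoly_var v - mpoly_const c \<in> P"
    using residue_of_variable[OF P assms(1)] by blast
  then obtain x where x: "mpoly_var v - mpoly_const (x v) \<in> P" for v
    by metis
  \<comment> \<open>Compatibility of congruence modulo \<open>P\<close> with products carries the
    congruences from variables to monomials, and from there linearly to all polynomials.\<close>
  have mult_cong: "a * b - a' * b' \<in> P" if "a - a' \<in> P" "b - b' \<in> P" for a a' b b'
  proof -
    have "a * b - a' * b' = b * (a - a') + a' * (b - b')" by (simp add: algebra_simps)
    then show ?thesis using that by (auto intro: mult_module.subspace_add[OF ideal] mult_in)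
  qed
  have power_cong: "a ^ k - b ^ k \<in> P" if "a - b \<in> P" for a b and k :: nat
    by (induction k) (auto intro: mult_module.subspace_0[OF ideal] mult_cong that)
  have monom: "Poly_Mapping.single m 1 - mpoly_const (monom_eval x m) \<in> P" for m
  proof (induction m rule: poly_mapping_additive_induct)
    case zero
    then show ?case by (simp add: mult_module.subspace_0[OF ideal])
  next
    case (single v k)
    have var: "mpoly_var v ^ k = Poly_Mapping.single (Poly_Mapping.single v k) (1 :: 'a)"
    proof (induction k)
      case (Suc k)
      show ?case by (simp add: Suc) (simp add: mpoly_var_def mult_single flip: single_add)
    qed simp
    have const: "mpoly_const (x v) ^ k = (mpoly_const (x v ^ k) :: ('v, 'a) mpoly)"
      by (induction k) (simp_all add: mpoly_const_mult)
    have "monom_eval x (Poly_Mapping.single v k) = x v ^ k"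
      by (cases "k = 0") (simp_all add: monom_eval_def)
    then show ?case
      using power_cong[OF x[of v], of k] by (simp add: var const)
  next
    case (add m m')
    from mult_cong[OF this] show ?case
      by (simp add: mult_single mpoly_const_mult monom_eval_add)
  qed
  \<comment> \<open>Evaluation at \<open>x\<close> is reduction modulo \<open>P\<close>. As nonzero
    constants are units, a polynomial lies in \<open>P\<close> exactly when it vanishes at
    \<open>x\<close>.\<close>
  have residue: "q - mpoly_const (mpoly_eval x q) \<in> P" for q
  proof (induction q rule: poly_mapping_additive_induct)
    case zero
    then show ?case by (simp add: mult_module.subspace_0[OF ideal])
  next
    case (single m c)
    have "Poly_Mapping.single m c - mpoly_const (c * monom_eval x m)
      = mpoly_const c * (Poly_Mapping.single m 1 - mpoly_const (monom_eval x m))"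
      by (simp add: mpoly_const_times_single mpoly_const_mult algebra_simps)
    then show ?case using mult_in[OF monom] by simp
  next
    case (add q r)
    from mult_module.subspace_add[OF ideal this] show ?case
      by (simp add: mpoly_eval_add mpoly_const_add algebra_simps)
  qed
  have "mpoly_eval x s = 0" if "s \<in> S" for s
  proof (rule ccontr)
    assume nonzero: "mpoly_eval x s \<noteq> 0"
    have "mpoly_const (mpoly_eval x s) \<in> P"
      using mult_module.subspace_diff[OF ideal _ residue[of s], of s] that \<open>S \<subseteq> P\<close> by auto
    moreover have "mpoly_const (inverse (mpoly_eval x s)) * mpoly_const (mpoly_eval x s) = (1 :: ('v, 'a) mpoly)"
      using nonzero by (simp flip: mpoly_const_mult)
    ultimately show False using unit_notin by blast
  qed
  then have "mpoly_eval x p = 0" by (rule vanishing)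
  then have "p \<in> P" using residue[of p] by simp
  then show False using avoids[of 1] by simp
qed

section \<open>Rings of polynomials and tensor products\<close>

lemma mpoly_ring_simps [simp]:
  "carrier (mpoly_ring I) = {p. \<forall>m \<in> Poly_Mapping.keys p. Poly_Mapping.keys m \<subseteq> I}"
  "mult (mpoly_ring I) = (*)" "add (mpoly_ring I) = (+)"
  "one (mpoly_ring I) = 1" "zero (mpoly_ring I) = 0"
  by (simp_all add: mpoly_ring_def ring_of_type_algebra_def)

lemma keys_mult_subset:
  assumes "\<forall>m \<in> Poly_Mapping.keys p. Poly_Mapping.keys m \<subseteq> I"
    "\<forall>m \<in> Poly_Mapping.keys q. Poly_Mapping.keys m \<subseteq> I" "m \<in> Poly_Mapping.keys (p * q)"
  shows "Poly_Mapping.keys m \<subseteq> I"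
proof -
  obtain a b where "m = a + b" "a \<in> Poly_Mapping.keys p" "b \<in> Poly_Mapping.keys q"
    using keys_mult[of p q] assms(3) by auto
  then show ?thesis using assms(1,2) keys_add[of a b] by blast
qed

lemma keys_add_subset:
  assumes "\<forall>m \<in> Poly_Mapping.keys p. P m" "\<forall>m \<in> Poly_Mapping.keys q. P m"
    "m \<in> Poly_Mapping.keys (p + q)"
  shows "P m"
  using assms keys_add[of p q] by blast

lemma mpoly_ring_cring: "cring (mpoly_ring I :: ('v, 'a::comm_ring_1) mpoly ring)"
proof (rule cringI)
  show "abelian_group (mpoly_ring I :: ('v, 'a) mpoly ring)"
  proof (rule abelian_groupI)
    fix x :: "('v, 'a) mpoly" assume "x \<in> carrier (mpoly_ring I)"
    then show "\<exists>y\<in>carrier (mpoly_ring I). y \<oplus>\<^bsub>mpoly_ring I\<^esub> x = \<zero>\<^bsub>mpoly_ring I\<^esub>"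
      by (intro bexI[of _ "- x"]) (auto simp: in_keys_iff)
  qed (auto simp: algebra_simps dest: keys_add_subset[rotated 2])
  show "Group.comm_monoid (mpoly_ring I :: ('v, 'a) mpoly ring)"
    by unfold_locales (auto simp: algebra_simps dest: keys_mult_subset[rotated 2])
qed (auto simp: algebra_simps)

lemma ring_minus_eqI:
  assumes "ring R" "x \<in> carrier R" "y \<in> carrier R" "y \<oplus>\<^bsub>R\<^esub> x = \<zero>\<^bsub>R\<^esub>"
  shows "\<ominus>\<^bsub>R\<^esub> x = y"
  using assms by (metis ring.is_abelian_group abelian_group.minus_equality)

lemma mpoly_ring_uminus:
  fixes x :: "('v, 'a::comm_ring_1) mpoly"
  assumes "x \<in> carrier (mpoly_ring I)"
  shows "\<ominus>\<^bsub>mpoly_ring I\<^esub> x = - x"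
  using assms by (intro ring_minus_eqI cring.axioms(1)[OF mpoly_ring_cring]) (auto simp: in_keys_iff)

section \<open>The ring of formal sums of pairs\<close>

lemma free_pair_ring_simps [simp]:
  "carrier (free_pair_ring A B) = {f. Poly_Mapping.keys f \<subseteq> carrier A \<times> carrier B}"
  "add (free_pair_ring A B) = (+)" "zero (free_pair_ring A B) = 0"
  "one (free_pair_ring A B) = frag_of (\<one>\<^bsub>A\<^esub>, \<one>\<^bsub>B\<^esub>)"
  by (simp_all add: free_pair_ring_def)

lemma frag_cmul_diff_distrib2: "frag_cmul c (a - b) = frag_cmul c a - frag_cmul c b"
  by (rule poly_mapping_eqI) (simp add: lookup_minus right_diff_distrib)

lemma frag_extend_fun_diff:
  "frag_extend (\<lambda>x. u x - v x) f = frag_extend u f - frag_extend v f"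
  by (simp add: frag_extend_def sum_subtractf frag_cmul_diff_distrib2)

text \<open>Closure under differences covers integer coefficients of both signs without mentioning
  scalars, and fits the multiplication, whose \<open>frag_extend\<close> is compatible with
  differences.\<close>

lemma free_pair_ring_induct [consumes 1, case_names zero pair diff]:
  assumes "f \<in> carrier (free_pair_ring A B)"
    and "P 0" "\<And>a b. a \<in> carrier A \<Longrightarrow> b \<in> carrier B \<Longrightarrow> P (frag_of (a, b))"
    and "\<And>f g. f \<in> carrier (free_pair_ring A B) \<Longrightarrow> g \<in> carrier (free_pair_ring A B) \<Longrightarrow>
      P f \<Longrightarrow> P g \<Longrightarrow> P (f - g)"
  shows "P f"
proof -
  have "f \<in> carrier (free_pair_ring A B) \<and> P f"
    using assms(1)[simplified]
  proof (induction f rule: frag_induction)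
    case (diff a b)
    then show ?case using assms(4)[of a b] keys_diff[of a b] by auto
  qed (use assms in \<open>auto simp: keys_frag_of\<close>)
  then show ?thesis ..
qed

lemma free_pair_ring_mult:
  "frag_of (a, b) \<otimes>\<^bsub>free_pair_ring A B\<^esub> frag_of (a', b') = frag_of (a \<otimes>\<^bsub>A\<^esub> a', b \<otimes>\<^bsub>B\<^esub> b')"
  "0 \<otimes>\<^bsub>free_pair_ring A B\<^esub> h = 0" "h \<otimes>\<^bsub>free_pair_ring A B\<^esub> 0 = 0"
  "(f - g) \<otimes>\<^bsub>free_pair_ring A B\<^esub> h = f \<otimes>\<^bsub>free_pair_ring A B\<^esub> h - g \<otimes>\<^bsub>free_pair_ring A B\<^esub> h"
  "h \<otimes>\<^bsub>free_pair_ring A B\<^esub> (f - g) = h \<otimes>\<^bsub>free_pair_ring A B\<^esub> f - h \<otimes>\<^bsub>free_pair_ring A B\<^esub> g"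
  by (simp_all add: free_pair_ring_def frag_extend_diff frag_extend_fun_diff split_def frag_extend_eq_0)

lemma free_pair_ring_add_mult:
  "(f + g) \<otimes>\<^bsub>free_pair_ring A B\<^esub> h = f \<otimes>\<^bsub>free_pair_ring A B\<^esub> h + g \<otimes>\<^bsub>free_pair_ring A B\<^esub> h"
  "h \<otimes>\<^bsub>free_pair_ring A B\<^esub> (f + g) = h \<otimes>\<^bsub>free_pair_ring A B\<^esub> f + h \<otimes>\<^bsub>free_pair_ring A B\<^esub> g"
  using free_pair_ring_mult(4)[where f = "f + g" and g = g and h = h and A = A and B = B]
    free_pair_ring_mult(5)[where f = "f + g" and g = g and h = h and A = A and B = B] by simp_all

text \<open>By biadditivity the multiplicative axioms reduce to pairs, where they hold
  componentwise.\<close>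

lemma free_pair_ring_ring:
  assumes "ring A" "ring B"
  shows "ring (free_pair_ring A B)"
proof (rule ringI)
  interpret A: ring A by fact
  interpret B: ring B by fact
  let ?F = "free_pair_ring A B"
  show "abelian_group ?F"
  proof (rule abelian_groupI)
    fix x assume "x \<in> carrier ?F"
    then show "\<exists>y\<in>carrier ?F. y \<oplus>\<^bsub>?F\<^esub> x = \<zero>\<^bsub>?F\<^esub>"
      by (intro bexI[of _ "- x"]) auto
  next
    fix x y assume "x \<in> carrier ?F" "y \<in> carrier ?F"
    then show "x \<oplus>\<^bsub>?F\<^esub> y \<in> carrier ?F"
      using keys_add[of x y] by auto
  qed (simp_all add: algebra_simps)
  have sub: "f - g \<in> carrier ?F" if "f \<in> carrier ?F" "g \<in> carrier ?F" for f g
    using that keys_diff[of f g] by auto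
  show "Group.monoid ?F"
  proof
    fix x y assume x: "x \<in> carrier ?F" and y: "y \<in> carrier ?F"
    show "x \<otimes>\<^bsub>?F\<^esub> y \<in> carrier ?F"
      using x
    proof (induction x rule: free_pair_ring_induct)
      case (pair a b)
      show ?case using y
        by (induction y rule: free_pair_ring_induct)
           (use pair in \<open>auto simp: free_pair_ring_mult simp del: free_pair_ring_simps(1) intro!: sub,
             simp_all\<close>)
    qed (auto simp: free_pair_ring_mult simp del: free_pair_ring_simps(1) intro!: sub, simp)
    fix z assume z: "z \<in> carrier ?F"
    show "x \<otimes>\<^bsub>?F\<^esub> y \<otimes>\<^bsub>?F\<^esub> z = x \<otimes>\<^bsub>?F\<^esub> (y \<otimes>\<^bsub>?F\<^esub> z)"
      using x
    proof (induction x rule: free_pair_ring_induct)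
      case x: (pair a b)
      show ?case using y
      proof (induction y rule: free_pair_ring_induct)
        case y: (pair c d)
        show ?case using z
          by (induction z rule: free_pair_ring_induct)
             (use x y in \<open>simp_all add: free_pair_ring_mult A.m_assoc B.m_assoc\<close>)
      qed (simp_all add: free_pair_ring_mult)
    qed (simp_all add: free_pair_ring_mult)
  next
    fix x assume "x \<in> carrier ?F"
    then show "\<one>\<^bsub>?F\<^esub> \<otimes>\<^bsub>?F\<^esub> x = x"
      by (induction x rule: free_pair_ring_induct) (simp_all add: free_pair_ring_mult)
  next
    fix x assume "x \<in> carrier ?F"
    then show "x \<otimes>\<^bsub>?F\<^esub> \<one>\<^bsub>?F\<^esub> = x"
      by (induction x rule: free_pair_ring_induct) (simp_all add: free_pair_ring_mult)
  qed (simp add: keys_frag_of)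
qed (simp_all add: free_pair_ring_add_mult)

lemma free_pair_ring_uminus:
  assumes "ring A" "ring B" "f \<in> carrier (free_pair_ring A B)"
  shows "\<ominus>\<^bsub>free_pair_ring A B\<^esub> f = - f"
  using assms by (intro ring_minus_eqI free_pair_ring_ring) auto

text \<open>The additive extension of a map on generators. In contrast to
  \<open>frag_extend\<close>, its values lie in an arbitrary ring instead of a free abelian
  group.\<close>

definition frag_lift :: "('k \<Rightarrow> 'r::ring_1) \<Rightarrow> ('k \<Rightarrow>\<^sub>0 int) \<Rightarrow> 'r" where
  "frag_lift \<phi> f = (\<Sum>k \<in> Poly_Mapping.keys f. of_int (Poly_Mapping.lookup f k) * \<phi> k)"

lemma frag_lift_zero [simp]: "frag_lift \<phi> 0 = 0"
  and frag_lift_of [simp]: "frag_lift \<phi> (frag_of k) = \<phi> k"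
  by (simp_all add: frag_lift_def)

lemma frag_lift_superset:
  assumes "finite A" "Poly_Mapping.keys f \<subseteq> A"
  shows "frag_lift \<phi> f = (\<Sum>k \<in> A. of_int (Poly_Mapping.lookup f k) * \<phi> k)"
  unfolding frag_lift_def
  by (rule sum.mono_neutral_left) (use assms in \<open>auto simp: in_keys_iff\<close>)

lemma frag_lift_diff: "frag_lift \<phi> (f - g) = frag_lift \<phi> f - frag_lift \<phi> g"
proof -
  let ?A = "Poly_Mapping.keys f \<union> Poly_Mapping.keys g"
  have "frag_lift \<phi> (f - g) = (\<Sum>k \<in> ?A. of_int (Poly_Mapping.lookup (f - g) k) * \<phi> k)"
    by (rule frag_lift_superset) (use keys_diff[of f g] in auto)
  also have "\<dots> = frag_lift \<phi> f - frag_lift \<phi> g"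
    by (subst (1 2) frag_lift_superset[of ?A])
       (auto simp: lookup_minus left_diff_distrib sum_subtractf)
  finally show ?thesis .
qed

lemma frag_lift_add: "frag_lift \<phi> (f + g) = frag_lift \<phi> f + frag_lift \<phi> g"
  using frag_lift_diff[of \<phi> "f + g" g] by (simp add: algebra_simps)

text \<open>On a coset of \<open>D\<close> the map \<open>h\<close> is constant, so the image of the
  coset is a singleton and \<open>the_elem\<close> extracts its value.\<close>

lemma ring_hom_factor:
  assumes "ring_hom_ring R S h" "ideal D R" "\<And>d. d \<in> D \<Longrightarrow> h d = \<zero>\<^bsub>S\<^esub>"
  defines "g \<equiv> \<lambda>U. the_elem (h ` U)"
  shows ring_hom_factor_apply: "f \<in> carrier R \<Longrightarrow> g (D +>\<^bsub>R\<^esub> f) = h f"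
    and ring_hom_factor_hom: "ring_hom_ring (R Quot D) S g"
proof -
  interpret ring_hom_ring R S h by fact
  interpret D: ideal D R by fact
  show factor: "g (D +>\<^bsub>R\<^esub> f) = h f" if f: "f \<in> carrier R" for f
  proof -
    have "h x = h f" if "x \<in> D +>\<^bsub>R\<^esub> f" for x
      using that f assms(3) by (auto simp: a_r_coset_def')
    moreover have "f \<in> D +>\<^bsub>R\<^esub> f" using f by (rule D.a_rcos_self)
    ultimately have "h ` (D +>\<^bsub>R\<^esub> f) = {h f}" by blast
    then show ?thesis by (simp add: g_def)
  qed
  show "ring_hom_ring (R Quot D) S g"
  proof (intro ring_hom_ringI2 D.quotient_is_ring S.ring_axioms ring_hom_memI)
    fix U assume "U \<in> carrier (R Quot D)"
    then obtain x where x: "U = D +>\<^bsub>R\<^esub> x" "x \<in> carrier R"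
      by (auto simp: FactRing_def A_RCOSETS_def')
    then show "g U \<in> carrier S" by (simp add: factor)
    fix W assume "W \<in> carrier (R Quot D)"
    then obtain y where y: "W = D +>\<^bsub>R\<^esub> y" "y \<in> carrier R"
      by (auto simp: FactRing_def A_RCOSETS_def')
    show "g (U \<otimes>\<^bsub>R Quot D\<^esub> W) = g U \<otimes>\<^bsub>S\<^esub> g W"
      using x y by (simp add: FactRing_def D.rcoset_mult_add factor)
    show "g (U \<oplus>\<^bsub>R Quot D\<^esub> W) = g U \<oplus>\<^bsub>S\<^esub> g W"
      using x y by (simp add: FactRing_def D.a_rcos_sum factor)
  next
    show "g \<one>\<^bsub>R Quot D\<^esub> = \<one>\<^bsub>S\<^esub>"
      by (simp add: FactRing_def factor)
  qed
qed

text \<open>Additive inverses are multiples by the negative of the unit, so closure under them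
  follows from closure under products.\<close>

lemma (in ring) ideal_closedI:
  assumes "I \<subseteq> carrier R" "\<zero> \<in> I" "\<And>x y. x \<in> I \<Longrightarrow> y \<in> I \<Longrightarrow> x \<oplus> y \<in> I"
    and l: "\<And>r x. r \<in> carrier R \<Longrightarrow> x \<in> I \<Longrightarrow> r \<otimes> x \<in> I"
    and r: "\<And>r x. r \<in> carrier R \<Longrightarrow> x \<in> I \<Longrightarrow> x \<otimes> r \<in> I"
  shows "ideal I R"
proof (rule idealI[OF ring_axioms])
  have "\<ominus> x \<in> I" if "x \<in> I" for x
  proof -
    have "\<ominus> x = \<ominus> \<one> \<otimes> x" using that assms(1) by (auto simp: l_minus)
    then show ?thesis using l that by simp
  qed
  then show "subgroup I (add_monoid R)"
    by unfold_locales (use assms in \<open>auto simp: a_inv_def[symmetric]\<close>)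
qed (use l r in auto)

section \<open>Integer polynomials over another coefficient ring\<close>

definition mpoly_of_int :: "('v, int) mpoly \<Rightarrow> ('v, 'a::comm_ring_1) mpoly" where
  "mpoly_of_int = Poly_Mapping.map of_int"

lemma lookup_mpoly_of_int [simp]:
  "Poly_Mapping.lookup (mpoly_of_int p) m = of_int (Poly_Mapping.lookup p m)"
  by (simp add: mpoly_of_int_def map.rep_eq when_def)

lemma mpoly_of_int_zero [simp]: "mpoly_of_int 0 = 0"
  by (rule poly_mapping_eqI) simp

lemma mpoly_of_int_add: "mpoly_of_int (p + q) = mpoly_of_int p + mpoly_of_int q"
  by (rule poly_mapping_eqI) (simp add: lookup_add)

lemma mpoly_of_int_diff: "mpoly_of_int (p - q) = mpoly_of_int p - mpoly_of_int q"
  by (rule poly_mapping_eqI) (simp add: lookup_minus)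

lemma mpoly_of_int_single [simp]:
  "mpoly_of_int (Poly_Mapping.single m c) = Poly_Mapping.single m (of_int c)"
  by (rule poly_mapping_eqI) (simp add: lookup_single when_def)

lemma mpoly_of_int_one [simp]: "mpoly_of_int 1 = 1"
  using mpoly_of_int_single[of 0 1] by simp

lemma mpoly_of_int_mult: "mpoly_of_int (p * q) = mpoly_of_int p * mpoly_of_int q"
proof (induction p rule: poly_mapping_additive_induct)
  case (single m c)
  show ?case
    by (induction q rule: poly_mapping_additive_induct)
       (simp_all add: mpoly_of_int_add mult_single algebra_simps)
qed (simp_all add: mpoly_of_int_add algebra_simps)

lemma keys_mpoly_of_int: "Poly_Mapping.keys (mpoly_of_int p) \<subseteq> Poly_Mapping.keys p"
  by (auto simp: in_keys_iff)

section \<open>Extension of scalars\<close>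

locale scalar_extension =
  fixes I :: "'v set" and S :: "('v, int) mpoly set" and B :: "'b::comm_ring_1 ring"
  assumes S_carrier: "S \<subseteq> carrier (mpoly_ring I)"
    and B_eq: "B = ring_of_type_algebra"
begin

abbreviation R :: "('v, int) mpoly ring" where "R \<equiv> mpoly_ring I"

abbreviation J :: "('v, int) mpoly set" where "J \<equiv> Idl\<^bsub>R\<^esub> S"

definition A :: "('v, int) mpoly set ring" where "A = R Quot J"

definition F :: "(('v, int) mpoly set \<times> 'b \<Rightarrow>\<^sub>0 int) ring" where "F = free_pair_ring A B"

definition D :: "(('v, int) mpoly set \<times> 'b \<Rightarrow>\<^sub>0 int) set" where
  "D = Idl\<^bsub>F\<^esub> (biadditivity_relations A B)"

text \<open>This ideal is formed with all variables of type \<open>'v\<close>, whereas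
  \<open>R\<close> uses only those in \<open>I\<close>. Since \<open>\<sigma>\<close> discards
  monomials with other variables, membership of \<open>\<Phi> f\<close> in \<open>L\<close> still
  detects membership of \<open>f\<close> in \<open>D\<close>.\<close>

abbreviation L :: "('v, 'b) mpoly set" where "L \<equiv> mult_module.span (mpoly_of_int ` S)"

abbreviation coset :: "('v, int) mpoly \<Rightarrow> ('v, int) mpoly set" where
  "coset a \<equiv> J +>\<^bsub>R\<^esub> a"

interpretation R: cring R by (rule mpoly_ring_cring)

interpretation J: ideal J R
  by (rule R.genideal_ideal[OF S_carrier])

lemma A_cring: "cring A"
  unfolding A_def by (rule J.quotient_is_cring[OF R.is_cring])

interpretation A: cring A by (rule A_cring)

lemma B_simps [simp]:
  "carrier B = UNIV" "mult B = (*)" "add B = (+)" "one B = 1" "zero B = 0"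
  by (simp_all add: B_eq ring_of_type_algebra_def)

lemma B_ring: "ring B"
  unfolding B_eq by (rule ring_from_type_algebra)

lemma F_ring: "ring F"
  unfolding F_def by (intro free_pair_ring_ring A.ring_axioms B_ring)

interpretation F: ring F by (rule F_ring)

lemma coset_in_A: "a \<in> carrier R \<Longrightarrow> coset a \<in> carrier A"
  unfolding A_def FactRing_def A_RCOSETS_def' by auto

lemma coset_ops:
  "\<one>\<^bsub>A\<^esub> = coset 1" "\<zero>\<^bsub>A\<^esub> = J"
  "a \<in> carrier R \<Longrightarrow> b \<in> carrier R \<Longrightarrow> coset a \<otimes>\<^bsub>A\<^esub> coset b = coset (a * b)"
  "a \<in> carrier R \<Longrightarrow> b \<in> carrier R \<Longrightarrow> coset a \<oplus>\<^bsub>A\<^esub> coset b = coset (a + b)"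
  using J.rcoset_mult_add[of a b] J.a_rcos_sum[of a b]
  by (simp_all add: A_def FactRing_def)

lemma coset_zero: "a \<in> J \<Longrightarrow> coset a = \<zero>\<^bsub>A\<^esub>"
  unfolding coset_ops by (rule J.a_rcos_const)

definition rep :: "('v, int) mpoly set \<Rightarrow> ('v, int) mpoly" where
  "rep x = (SOME a. a \<in> x)"

lemma rep_in_coset: "a \<in> carrier R \<Longrightarrow> rep (coset a) \<in> coset a"
  unfolding rep_def by (rule someI[of _ a]) (rule J.a_rcos_self)

lemma rep:
  assumes "x \<in> carrier A"
  shows "rep x \<in> carrier R" "coset (rep x) = x"
proof -
  obtain a where a: "a \<in> carrier R" "x = coset a"
    using assms unfolding A_def FactRing_def A_RCOSETS_def' by auto
  have r: "rep x \<in> coset a" using rep_in_coset a by simp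
  then show "rep x \<in> carrier R"
    using J.a_elemrcos_carrier[OF a(1)] by blast
  show "coset (rep x) = x"
    using J.a_repr_independence'[OF r a(1)] a(2) by simp
qed

lemma L_mult: "q \<in> L \<Longrightarrow> p * q \<in> L"
  by (rule mult_module.span_scale)

lemma L_trans: "p - q \<in> L \<Longrightarrow> q - r \<in> L \<Longrightarrow> p - r \<in> L"
  using mult_module.span_add[of "p - q" _ "q - r"] by simp

text \<open>The elements of \<open>R\<close> whose images lie in \<open>L\<close> form an ideal
  containing \<open>S\<close>, and \<open>J\<close> is the least such ideal.\<close>

lemma mpoly_of_int_ideal:
  assumes "a \<in> J"
  shows "mpoly_of_int a \<in> L"
proof -
  have "ideal {a \<in> carrier R. mpoly_of_int a \<in> L} R"
  proof (rule R.ideal_closedI)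
    fix r x assume r: "r \<in> carrier R" and x: "x \<in> {a \<in> carrier R. mpoly_of_int a \<in> L}"
    then show "r \<otimes>\<^bsub>R\<^esub> x \<in> {a \<in> carrier R. mpoly_of_int a \<in> L}"
      using R.m_closed[of r x] by (simp add: mpoly_of_int_mult L_mult)
    from r x show "x \<otimes>\<^bsub>R\<^esub> r \<in> {a \<in> carrier R. mpoly_of_int a \<in> L}"
      using R.m_closed[of x r] by (simp add: mpoly_of_int_mult L_mult mult.commute[of "mpoly_of_int x"])
  next
    fix x y assume "x \<in> {a \<in> carrier R. mpoly_of_int a \<in> L}" "y \<in> {a \<in> carrier R. mpoly_of_int a \<in> L}"
    then show "x \<oplus>\<^bsub>R\<^esub> y \<in> {a \<in> carrier R. mpoly_of_int a \<in> L}"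
      using R.a_closed[of x y] by (simp add: mpoly_of_int_add mult_module.span_add)
  qed (auto simp: mult_module.span_zero)
  moreover have "S \<subseteq> {a \<in> carrier R. mpoly_of_int a \<in> L}"
    using S_carrier by (auto intro: mult_module.span_base)
  ultimately have "J \<subseteq> {a \<in> carrier R. mpoly_of_int a \<in> L}"
    by (rule R.genideal_minimal)
  then show ?thesis using assms by blast
qed

lemma mpoly_of_int_rep:
  assumes "a \<in> carrier R"
  shows "mpoly_of_int (rep (coset a)) - mpoly_of_int a \<in> L"
proof -
  obtain j where "j \<in> J" "rep (coset a) = j + a"
    using rep_in_coset[OF assms] unfolding a_r_coset_def' by auto
  then show ?thesis by (simp add: mpoly_of_int_add mpoly_of_int_ideal)
qed

text \<open>Modulo \<open>L\<close>, the map \<open>\<Phi>\<close> does not depend on the chosen representatives. It induces the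
  isomorphism \<open>(\<int>[X]/J) \<otimes> B \<rightarrow> B[X]/L\<close>, whose inverse is induced by \<open>\<sigma>\<close> below.\<close>

definition \<Phi> :: "(('v, int) mpoly set \<times> 'b \<Rightarrow>\<^sub>0 int) \<Rightarrow> ('v, 'b) mpoly" where
  "\<Phi> = frag_lift (\<lambda>(x, c). mpoly_const c * mpoly_of_int (rep x))"

lemma \<Phi>_diff: "\<Phi> (f - g) = \<Phi> f - \<Phi> g"
  and \<Phi>_add: "\<Phi> (f + g) = \<Phi> f + \<Phi> g"
  and \<Phi>_zero [simp]: "\<Phi> 0 = 0"
  and \<Phi>_pair: "\<Phi> (frag_of (x, c)) = mpoly_const c * mpoly_of_int (rep x)"
  by (simp_all add: \<Phi>_def frag_lift_diff frag_lift_add)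

lemma \<Phi>_coset:
  assumes "a \<in> carrier R"
  shows "\<Phi> (frag_of (coset a, c)) - mpoly_const c * mpoly_of_int a \<in> L"
  using L_mult[OF mpoly_of_int_rep[OF assms], of "mpoly_const c"]
  by (simp add: \<Phi>_pair right_diff_distrib)

text \<open>Equality can fail: the chosen representative of a product of cosets and the product of
  the representatives differ by an element of \<open>J\<close>, which \<open>mpoly_of_int\<close>
  sends into \<open>L\<close>.\<close>

lemma \<Phi>_mult:
  assumes "f \<in> carrier F" "g \<in> carrier F"
  shows "\<Phi> (f \<otimes>\<^bsub>F\<^esub> g) - \<Phi> f * \<Phi> g \<in> L"
  using assms(1) unfolding F_def
proof (induction f rule: free_pair_ring_induct)
  case (pair x c)
  show ?case using assms(2) unfolding F_def
  proof (induction g rule: free_pair_ring_induct)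
    case (pair y d)
    have "x \<otimes>\<^bsub>A\<^esub> y = coset (rep x * rep y)"
      using coset_ops(3)[of "rep x" "rep y"] rep[OF pair(1)] rep[OF \<open>x \<in> carrier A\<close>] by simp
    moreover have "rep x * rep y \<in> carrier R"
      using R.m_closed[OF rep(1)[OF \<open>x \<in> carrier A\<close>] rep(1)[OF pair(1)]] by simp
    from \<Phi>_coset[OF this, of "c * d"]
    have "\<Phi> (frag_of (coset (rep x * rep y), c * d)) - \<Phi> (frag_of (x, c)) * \<Phi> (frag_of (y, d)) \<in> L"
      by (simp add: \<Phi>_pair mpoly_const_mult mpoly_of_int_mult algebra_simps)
    ultimately show ?case by (simp add: free_pair_ring_mult)
  next
    case (diff f g)
    from mult_module.span_diff[OF diff(3,4)] show ?case
      by (simp add: free_pair_ring_mult \<Phi>_diff algebra_simps)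
  qed (simp add: free_pair_ring_mult mult_module.span_zero)
next
  case (diff f g)
  from mult_module.span_diff[OF diff(3,4)] show ?case
    by (simp add: free_pair_ring_mult \<Phi>_diff algebra_simps)
qed (simp add: free_pair_ring_mult mult_module.span_zero)

lemma \<Phi>_one: "\<Phi> \<one>\<^bsub>F\<^esub> - 1 \<in> L"
  using \<Phi>_coset[of 1 1] by (simp add: F_def coset_ops)

lemma \<Phi>_pow:
  assumes "f \<in> carrier F"
  shows "\<Phi> (f [^]\<^bsub>F\<^esub> (k::nat)) - \<Phi> f ^ k \<in> L"
proof (induction k)
  case 0
  then show ?case using \<Phi>_one by simp
next
  case (Suc k)
  have "\<Phi> (f [^]\<^bsub>F\<^esub> k \<otimes>\<^bsub>F\<^esub> f) - \<Phi> (f [^]\<^bsub>F\<^esub> k) * \<Phi> f \<in> L"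
    by (intro \<Phi>_mult F.nat_pow_closed assms)
  moreover have "\<Phi> (f [^]\<^bsub>F\<^esub> k) * \<Phi> f - \<Phi> f ^ Suc k \<in> L"
    using L_mult[OF Suc, of "\<Phi> f"] by (simp add: algebra_simps)
  ultimately have "\<Phi> (f [^]\<^bsub>F\<^esub> k \<otimes>\<^bsub>F\<^esub> f) - \<Phi> f ^ Suc k \<in> L"
    by (rule L_trans)
  then show ?case by simp
qed

lemma keys_\<Phi>:
  assumes "f \<in> carrier F"
  shows "\<Phi> f \<in> carrier (mpoly_ring I)"
  using assms unfolding F_def
proof (induction f rule: free_pair_ring_induct)
  case (pair x c)
  have "Poly_Mapping.keys (mpoly_const c * mpoly_of_int (rep x)) \<subseteq> Poly_Mapping.keys (rep x)"
    by (auto simp: in_keys_iff lookup_mpoly_const_times)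
  then show ?case using rep(1)[OF pair(1)] by (auto simp: \<Phi>_pair)
next
  case (diff f g)
  then show ?case using keys_diff[of "\<Phi> f" "\<Phi> g"] by (simp add: \<Phi>_diff) blast
qed simp

section \<open>The biadditivity ideal\<close>

lemma biadditivity_relations_carrier: "biadditivity_relations A B \<subseteq> carrier F"
proof -
  have diff: "f - g - h \<in> carrier F" if "f \<in> carrier F" "g \<in> carrier F" "h \<in> carrier F" for f g h
    using that keys_diff[of f g] keys_diff[of "f - g" h] by (simp add: F_def) blast
  moreover have pair: "frag_of (x, c) \<in> carrier F \<longleftrightarrow> x \<in> carrier A" for x c
    by (simp add: F_def keys_frag_of)
  ultimately show ?thesis
    unfolding biadditivity_relations_def
    by (auto intro!: diff simp: pair)
qed

lemma D_ideal: "ideal D F"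
  unfolding D_def by (rule F.genideal_ideal[OF biadditivity_relations_carrier])

interpretation D: ideal D F by (rule D_ideal)

lemma D_zero: "0 \<in> D"
  using D.zero_closed by (simp add: F_def)

lemma D_add: "f \<in> D \<Longrightarrow> g \<in> D \<Longrightarrow> f + g \<in> D"
  using D.a_closed[of f g] by (simp add: F_def)

lemma D_uminus:
  assumes "f \<in> D"
  shows "- f \<in> D"
proof -
  have "\<ominus>\<^bsub>F\<^esub> f = - f"
    using D.a_Hcarr[OF assms] unfolding F_def
    by (intro free_pair_ring_uminus A.ring_axioms B_ring)
  then show ?thesis using D.a_inv_closed[OF assms] by simp
qed

lemma D_diff: "f \<in> D \<Longrightarrow> g \<in> D \<Longrightarrow> f - g \<in> D"
  using D_add[of f "- g"] D_uminus[of g] by simp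

lemma D_sum: "(\<And>m. m \<in> M \<Longrightarrow> f m \<in> D) \<Longrightarrow> sum f M \<in> D"
  by (induction M rule: infinite_finite_induct) (auto simp: D_zero D_add)

lemma D_relations: "biadditivity_relations A B \<subseteq> D"
  unfolding D_def by (rule F.genideal_self[OF biadditivity_relations_carrier])

lemma D_add_left:
  assumes "x \<in> carrier A" "y \<in> carrier A"
  shows "frag_of (x \<oplus>\<^bsub>A\<^esub> y, c) - frag_of (x, c) - frag_of (y, c) \<in> D"
proof (rule subsetD[OF D_relations])
  have "c \<in> carrier B" by simp
  then show "frag_of (x \<oplus>\<^bsub>A\<^esub> y, c) - frag_of (x, c) - frag_of (y, c) \<in> biadditivity_relations A B"
    unfolding biadditivity_relations_def using assms by blast
qed

lemma D_add_right:
  assumes "x \<in> carrier A"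
  shows "frag_of (x, c + d) - frag_of (x, c) - frag_of (x, d) \<in> D"
proof -
  have "c \<in> carrier B" "d \<in> carrier B" by simp_all
  then have "frag_of (x, c \<oplus>\<^bsub>B\<^esub> d) - frag_of (x, c) - frag_of (x, d) \<in> biadditivity_relations A B"
    unfolding biadditivity_relations_def using assms by blast
  then show ?thesis using D_relations by auto
qed

text \<open>For two zero summands the additivity relation collapses to the negative of the
  pair.\<close>

lemma D_zero_left: "frag_of (\<zero>\<^bsub>A\<^esub>, c) \<in> D"
  using D_uminus[OF D_add_left[of "\<zero>\<^bsub>A\<^esub>" "\<zero>\<^bsub>A\<^esub>" c]] by simp

lemma D_zero_right: "x \<in> carrier A \<Longrightarrow> frag_of (x, 0) \<in> D"
  using D_uminus[OF D_add_right[of x 0 0]] by simp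

text \<open>The preimage of \<open>L\<close> is an ideal of \<open>F\<close>. It contains the
  relations, because \<open>\<Phi>\<close> is exactly additive in the scalar and additive modulo
  \<open>L\<close> in the coset.\<close>

lemma \<Phi>_D:
  assumes "f \<in> D"
  shows "\<Phi> f \<in> L"
proof -
  let ?K = "{f \<in> carrier F. \<Phi> f \<in> L}"
  have "ideal ?K F"
  proof (rule F.ideal_closedI)
    fix r x assume r: "r \<in> carrier F" and x: "x \<in> ?K"
    have "\<Phi> (r \<otimes>\<^bsub>F\<^esub> x) - \<Phi> r * \<Phi> x \<in> L" "\<Phi> (x \<otimes>\<^bsub>F\<^esub> r) - \<Phi> r * \<Phi> x \<in> L"
      using \<Phi>_mult[of r x] \<Phi>_mult[of x r] r x by (simp_all add: mult.commute)
    moreover have "\<Phi> r * \<Phi> x - 0 \<in> L" using x L_mult by simp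
    ultimately have "\<Phi> (r \<otimes>\<^bsub>F\<^esub> x) \<in> L" "\<Phi> (x \<otimes>\<^bsub>F\<^esub> r) \<in> L"
      using L_trans[of _ "\<Phi> r * \<Phi> x" 0] by simp_all
    then show "r \<otimes>\<^bsub>F\<^esub> x \<in> ?K" "x \<otimes>\<^bsub>F\<^esub> r \<in> ?K"
      using r x by auto
  next
    fix x y assume "x \<in> ?K" "y \<in> ?K"
    moreover have "x \<oplus>\<^bsub>F\<^esub> y = x + y" by (simp add: F_def)
    ultimately show "x \<oplus>\<^bsub>F\<^esub> y \<in> ?K"
      using F.a_closed[of x y] by (simp add: \<Phi>_add mult_module.span_add)
  qed (auto simp: mult_module.span_zero F_def)
  moreover have "biadditivity_relations A B \<subseteq> ?K"
  proof -
    have "\<Phi> (frag_of (x \<oplus>\<^bsub>A\<^esub> y, c) - frag_of (x, c) - frag_of (y, c)) \<in> L"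
      if "x \<in> carrier A" "y \<in> carrier A" for x y c
    proof -
      have "x \<oplus>\<^bsub>A\<^esub> y = coset (rep x + rep y)"
        using coset_ops(4)[of "rep x" "rep y"] rep[OF that(1)] rep[OF that(2)] by simp
      moreover have "rep x + rep y \<in> carrier R"
        using R.a_closed[OF rep(1)[OF that(1)] rep(1)[OF that(2)]] by simp
      ultimately show ?thesis
        using \<Phi>_coset[of "rep x + rep y" c]
        by (simp add: \<Phi>_diff \<Phi>_add \<Phi>_pair mpoly_of_int_add algebra_simps)
    qed
    moreover have "\<Phi> (frag_of (x, c + d) - frag_of (x, c) - frag_of (x, d)) \<in> L" for x c d
      by (simp add: \<Phi>_diff \<Phi>_add \<Phi>_pair mpoly_const_add algebra_simps mult_module.span_zero)
    ultimately have "\<Phi> f \<in> L" if "f \<in> biadditivity_relations A B" for f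
      using that unfolding biadditivity_relations_def B_simps by auto
    then show ?thesis
      using biadditivity_relations_carrier by blast
  qed
  ultimately have "D \<subseteq> ?K"
    unfolding D_def by (rule F.genideal_minimal)
  then show ?thesis using assms by blast
qed

text \<open>The value 0 at \<open>c = 0\<close> allows \<open>\<sigma>\<close> to be summed over any
  finite superset of the support; it agrees modulo \<open>D\<close> with the pair
  \<open>(coset (frag_of m), 0)\<close>. The value 0 at monomials with variables outside
  \<open>I\<close>, which are not in \<open>R\<close>, keeps \<open>\<sigma>\<close> inside
  \<open>F\<close>.\<close>

definition \<tau> :: "('v \<Rightarrow>\<^sub>0 nat) \<Rightarrow> 'b \<Rightarrow> (('v, int) mpoly set \<times> 'b \<Rightarrow>\<^sub>0 int)" where
  "\<tau> m c = (if Poly_Mapping.keys m \<subseteq> I \<and> c \<noteq> 0 then frag_of (coset (frag_of m), c) else 0)"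

definition \<sigma> :: "('v, 'b) mpoly \<Rightarrow> (('v, int) mpoly set \<times> 'b \<Rightarrow>\<^sub>0 int)" where
  "\<sigma> p = (\<Sum>m \<in> Poly_Mapping.keys p. \<tau> m (Poly_Mapping.lookup p m))"

lemma monomial_carrier: "Poly_Mapping.keys m \<subseteq> I \<Longrightarrow> frag_of m \<in> carrier R"
  by simp

lemma \<tau>_cong:
  assumes "Poly_Mapping.keys m \<subseteq> I"
  shows "\<tau> m c - frag_of (coset (frag_of m), c) \<in> D"
  using assms D_uminus[OF D_zero_right[OF coset_in_A[OF monomial_carrier]]]
  by (auto simp: \<tau>_def D_zero)

lemma \<tau>_add: "\<tau> m (c + d) - \<tau> m c - \<tau> m d \<in> D"
proof (cases "Poly_Mapping.keys m \<subseteq> I")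
  case True
  let ?X = "\<lambda>c. frag_of (coset (frag_of m), c)"
  have "\<tau> m (c + d) - \<tau> m c - \<tau> m d = (\<tau> m (c + d) - ?X (c + d)) - (\<tau> m c - ?X c) - (\<tau> m d - ?X d)
      + (?X (c + d) - ?X c - ?X d)"
    by simp
  also have "\<dots> \<in> D"
    by (intro D_add D_diff \<tau>_cong True D_add_right coset_in_A monomial_carrier)
  finally show ?thesis .
qed (simp add: \<tau>_def D_zero)

lemma \<tau>_zero [simp]: "\<tau> m 0 = 0"
  by (simp add: \<tau>_def)

lemma \<sigma>_superset:
  assumes "finite M" "Poly_Mapping.keys p \<subseteq> M"
  shows "\<sigma> p = (\<Sum>m \<in> M. \<tau> m (Poly_Mapping.lookup p m))"
  unfolding \<sigma>_def
  by (rule sum.mono_neutral_left) (use assms in \<open>auto simp: in_keys_iff\<close>)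

lemma \<sigma>_zero [simp]: "\<sigma> 0 = 0"
  by (simp add: \<sigma>_def)

lemma \<sigma>_single: "\<sigma> (Poly_Mapping.single m c) = \<tau> m c"
  by (simp add: \<sigma>_superset[of "{m}"])

lemma \<sigma>_add: "\<sigma> (p + q) - \<sigma> p - \<sigma> q \<in> D"
proof -
  let ?M = "Poly_Mapping.keys p \<union> Poly_Mapping.keys q"
  have "\<sigma> (p + q) = (\<Sum>m \<in> ?M. \<tau> m (Poly_Mapping.lookup (p + q) m))"
    by (rule \<sigma>_superset) (use keys_add[of p q] in auto)
  moreover have "\<sigma> p = (\<Sum>m \<in> ?M. \<tau> m (Poly_Mapping.lookup p m))"
    "\<sigma> q = (\<Sum>m \<in> ?M. \<tau> m (Poly_Mapping.lookup q m))"
    by (rule \<sigma>_superset; simp)+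
  ultimately have "\<sigma> (p + q) - \<sigma> p - \<sigma> q = (\<Sum>m \<in> ?M. \<tau> m (Poly_Mapping.lookup p m + Poly_Mapping.lookup q m)
      - \<tau> m (Poly_Mapping.lookup p m) - \<tau> m (Poly_Mapping.lookup q m))"
    by (simp add: sum_subtractf lookup_add)
  also have "\<dots> \<in> D" by (intro D_sum \<tau>_add)
  finally show ?thesis .
qed

lemma \<sigma>_add_in: "\<sigma> p \<in> D \<Longrightarrow> \<sigma> q \<in> D \<Longrightarrow> \<sigma> (p + q) \<in> D"
  using D_add[OF D_add[OF \<sigma>_add[of p q]], of "\<sigma> p" "\<sigma> q"] by (simp add: algebra_simps)

lemma \<sigma>_diff: "\<sigma> (p - q) - \<sigma> p + \<sigma> q \<in> D"
  using D_uminus[OF \<sigma>_add[of "p - q" q]] by (simp add: algebra_simps)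

text \<open>Both terms are additive in \<open>a\<close> modulo \<open>D\<close>, so it suffices to
  compare them at a monomial, where they agree up to the default value of
  \<open>\<tau>\<close>.\<close>

lemma \<sigma>_scaled:
  assumes "a \<in> carrier R"
  shows "\<sigma> (mpoly_const c * mpoly_of_int a) - frag_of (coset a, c) \<in> D"
proof -
  let ?P = "\<lambda>a. a \<in> carrier R \<and> \<sigma> (mpoly_const c * mpoly_of_int a) - frag_of (coset a, c) \<in> D"
  have "Poly_Mapping.keys a \<subseteq> {m. Poly_Mapping.keys m \<subseteq> I}" using assms by auto
  then have "?P a"
  proof (induction a rule: frag_induction)
    case zero
    have "coset 0 = \<zero>\<^bsub>A\<^esub>" using coset_zero[of 0] J.zero_closed by simp
    then show ?case using D_uminus[OF D_zero_left[of c]] by simp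
  next
    case (one m)
    then show ?case
      using \<tau>_cong[of m c] by (simp add: \<sigma>_single mpoly_const_times_single)
  next
    case (diff a b)
    let ?X = "\<lambda>a. frag_of (coset a, c)" and ?s = "\<lambda>a. \<sigma> (mpoly_const c * mpoly_of_int a)"
    have ab: "a - b \<in> carrier R" "b \<in> carrier R"
      using diff keys_diff[of a b] by auto
    then have rel: "?X a - ?X (a - b) - ?X b \<in> D"
      using D_add_left[OF coset_in_A[OF ab(1)] coset_in_A[OF ab(2)], of c] coset_ops(4)[OF ab] by simp
    have "?s (a - b) - ?s a + ?s b \<in> D"
      using \<sigma>_diff[of "mpoly_const c * mpoly_of_int a" "mpoly_const c * mpoly_of_int b"]
      by (simp add: mpoly_of_int_diff right_diff_distrib)
    moreover have a: "?s a - ?X a \<in> D" and b: "?s b - ?X b \<in> D" using diff by auto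
    ultimately have "(?s (a - b) - ?s a + ?s b) + (?s a - ?X a) - (?s b - ?X b)
        + (?X a - ?X (a - b) - ?X b) \<in> D"
      using D_add[OF D_diff[OF D_add[OF _ a] b] rel] by blast
    then show ?case using ab by simp
  qed
  then show ?thesis ..
qed

lemma \<sigma>_\<Phi>:
  assumes "f \<in> carrier F"
  shows "\<sigma> (\<Phi> f) - f \<in> D"
  using assms unfolding F_def
proof (induction f rule: free_pair_ring_induct)
  case (pair x c)
  then show ?case using \<sigma>_scaled[OF rep(1)[OF pair(1)], of c] rep(2)[OF pair(1)]
    by (simp add: \<Phi>_pair)
next
  case (diff f g)
  have "(\<sigma> (\<Phi> f - \<Phi> g) - \<sigma> (\<Phi> f) + \<sigma> (\<Phi> g)) + (\<sigma> (\<Phi> f) - f) - (\<sigma> (\<Phi> g) - g) \<in> D"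
    by (rule D_diff[OF D_add[OF \<sigma>_diff diff(3)] diff(4)])
  then show ?case by (simp add: \<Phi>_diff algebra_simps)
qed (simp add: D_zero)

text \<open>If the monomial \<open>m\<close> uses only variables in \<open>I\<close>, then
  \<open>frag_of m * s\<close> lies in \<open>J\<close> and its coset is zero. Otherwise every
  monomial of the product involves a variable outside \<open>I\<close>, and \<open>\<sigma>\<close>
  kills the product.\<close>

lemma \<sigma>_multiple_of_relation:
  assumes "s \<in> S"
  shows "\<sigma> (q * mpoly_of_int s) \<in> D"
proof (induction q rule: poly_mapping_additive_induct)
  case (single m c)
  have eq: "Poly_Mapping.single m c * mpoly_of_int s = mpoly_const c * mpoly_of_int (frag_of m * s)"
    by (simp add: mpoly_of_int_mult mpoly_const_times_single flip: mult.assoc)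
  show ?case
  proof (cases "Poly_Mapping.keys m \<subseteq> I")
    case True
    have s: "s \<in> J" using R.genideal_self[OF S_carrier] assms by blast
    have "frag_of m * s \<in> J"
      using J.I_l_closed[OF s monomial_carrier[OF True]] by simp
    then have c: "coset (frag_of m * s) = \<zero>\<^bsub>A\<^esub>" "frag_of m * s \<in> carrier R"
      by (rule coset_zero, rule J.Icarr)
    from D_add[OF \<sigma>_scaled[OF c(2), of c] D_zero_left[of c]] show ?thesis
      unfolding eq c(1) by simp
  next
    case False
    have "\<tau> n d = 0" if n: "n \<in> Poly_Mapping.keys (Poly_Mapping.single m c * mpoly_of_int s)" for n d
    proof -
      obtain m' n' where "n = m' + n'" "m' \<in> Poly_Mapping.keys (Poly_Mapping.single m c)"
        using keys_mult[of "Poly_Mapping.single m c" "mpoly_of_int s"] n by blast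
      then have "n = m + n'" by (cases "c = 0") auto
      then have "Poly_Mapping.keys m \<subseteq> Poly_Mapping.keys n"
        by (auto simp: in_keys_iff lookup_add)
      then show ?thesis using False by (auto simp: \<tau>_def)
    qed
    then show ?thesis by (simp add: \<sigma>_def D_zero)
  qed
qed (simp_all add: D_zero distrib_right \<sigma>_add_in)

lemma \<sigma>_L: "p \<in> L \<Longrightarrow> \<sigma> p \<in> D"
  by (induction rule: mult_module.span_induct_alt)
     (auto simp: D_zero intro!: \<sigma>_add_in \<sigma>_multiple_of_relation)

text \<open>Injectivity of the induced map: \<open>\<sigma>\<close> recovers \<open>f\<close> from
  \<open>\<Phi> f\<close> modulo \<open>D\<close> and sends \<open>L\<close> into
  \<open>D\<close>.\<close>

lemma \<Phi>_in_L_iff: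
  assumes "f \<in> carrier F"
  shows "\<Phi> f \<in> L \<longleftrightarrow> f \<in> D"
proof
  assume "\<Phi> f \<in> L"
  from D_diff[OF \<sigma>_L[OF this] \<sigma>_\<Phi>[OF assms]] show "f \<in> D" by simp
qed (rule \<Phi>_D)

lemma \<sigma>_carrier: "\<sigma> p \<in> carrier F"
proof -
  have "\<tau> m c \<in> carrier F" for m c
    using coset_in_A[OF monomial_carrier] by (auto simp: \<tau>_def F_def keys_frag_of)
  then show ?thesis
    unfolding \<sigma>_def F_def by simp (use keys_sum in fastforce)
qed

text \<open>Surjectivity of the induced map; by additivity of \<open>\<Phi>\<close> it is checked
  one term of \<open>p\<close> at a time.\<close>

lemma \<Phi>_\<sigma>:
  assumes "p \<in> carrier (mpoly_ring I)"
  shows "\<Phi> (\<sigma> p) - p \<in> L"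
proof -
  have p: "p = (\<Sum>m \<in> Poly_Mapping.keys p. Poly_Mapping.single m (Poly_Mapping.lookup p m))"
    by (rule poly_mapping_eqI) (simp add: lookup_sum lookup_single when_def in_keys_iff)
  have \<Phi>_sum: "\<Phi> (sum f M) = (\<Sum>m\<in>M. \<Phi> (f m))" for f :: "('v \<Rightarrow>\<^sub>0 nat) \<Rightarrow> _" and M
    by (induction M rule: infinite_finite_induct) (simp_all add: \<Phi>_add)
  have "\<Phi> (\<tau> m c) - Poly_Mapping.single m c \<in> L" if "m \<in> Poly_Mapping.keys p" for m c
  proof -
    have m: "Poly_Mapping.keys m \<subseteq> I" using that assms by auto
    then show ?thesis
      using \<Phi>_coset[OF monomial_carrier[OF m], of c]
      by (auto simp: \<tau>_def mpoly_const_times_single mult_module.span_zero)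
  qed
  then have "(\<Sum>m \<in> Poly_Mapping.keys p. \<Phi> (\<tau> m (Poly_Mapping.lookup p m))
      - Poly_Mapping.single m (Poly_Mapping.lookup p m)) \<in> L"
    by (rule mult_module.span_sum)
  then show ?thesis
    unfolding sum_subtractf p[symmetric] by (simp add: \<sigma>_def \<Phi>_sum)
qed

end

section \<open>Coordinate rings\<close>

text \<open>Points of a variety carry the value \<open>undefined\<close> outside \<open>I\<close>,
  whereas the Nullstellensatz quantifies over arbitrary values of all variables. Polynomials in
  \<open>I\<close> do not see the difference.\<close>

lemma mpoly_eval_restrict:
  assumes "p \<in> carrier (mpoly_ring I)"
  shows "mpoly_eval (restrict x I) p = mpoly_eval x p"
  by (rule mpoly_eval_cong) (use assms in auto)

lemma uncountable_UNIV_complex: "uncountable (UNIV :: complex set)"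
proof
  assume "countable (UNIV :: complex set)"
  then have "countable (range complex_of_real)" by (rule countable_subset[rotated]) simp
  then have "countable (UNIV :: real set)"
    by (rule countable_image_inj_on) (simp add: inj_def)
  then show False using uncountable_UNIV_real by simp
qed

lemma vanishing_ideal_ideal:
  fixes I :: "'v set"
  shows "ideal (vanishing_ideal I V) (mpoly_ring I)"
proof -
  interpret C: cring "mpoly_ring I :: ('v, complex) mpoly ring" by (rule mpoly_ring_cring)
  show ?thesis
  proof (rule C.ideal_closedI)
    fix r x :: "('v, complex) mpoly"
    assume r: "r \<in> carrier (mpoly_ring I)" and x: "x \<in> vanishing_ideal I V"
    then have "x \<in> carrier (mpoly_ring I)" by (simp add: vanishing_ideal_def)
    then show "r \<otimes>\<^bsub>mpoly_ring I\<^esub> x \<in> vanishing_ideal I V" "x \<otimes>\<^bsub>mpoly_ring I\<^esub> r \<in> vanishing_ideal I V"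
      using x C.m_closed[OF r, of x] C.m_closed[OF _ r, of x]
      by (simp_all add: vanishing_ideal_def mpoly_eval_mult)
  next
    fix x y :: "('v, complex) mpoly"
    assume "x \<in> vanishing_ideal I V" "y \<in> vanishing_ideal I V"
    then show "x \<oplus>\<^bsub>mpoly_ring I\<^esub> y \<in> vanishing_ideal I V"
      using C.a_closed[of x y] by (simp add: vanishing_ideal_def mpoly_eval_add)
  qed (auto simp: vanishing_ideal_def)
qed

lemma vanishing_ideal_cong:
  fixes I :: "'v set"
  assumes "p \<in> carrier (mpoly_ring I)" "q \<in> carrier (mpoly_ring I)"
    and "\<And>x. x \<in> V \<Longrightarrow> mpoly_eval x p = mpoly_eval x q"
  shows "vanishing_ideal I V +>\<^bsub>mpoly_ring I\<^esub> p = vanishing_ideal I V +>\<^bsub>mpoly_ring I\<^esub> q"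
proof -
  interpret C: cring "mpoly_ring I :: ('v, complex) mpoly ring" by (rule mpoly_ring_cring)
  have "p \<ominus>\<^bsub>mpoly_ring I\<^esub> q = p - q"
    using assms(2) by (simp only: a_minus_def mpoly_ring_uminus) simp
  moreover have "p \<ominus>\<^bsub>mpoly_ring I\<^esub> q \<in> carrier (mpoly_ring I)"
    by (rule C.minus_closed[OF assms(1,2)])
  ultimately have "p \<ominus>\<^bsub>mpoly_ring I\<^esub> q \<in> vanishing_ideal I V"
    using assms(3) by (simp add: vanishing_ideal_def mpoly_eval_diff)
  then show ?thesis
    by (simp only: C.quotient_eq_iff_same_a_r_cos[OF vanishing_ideal_ideal assms(1,2)])
qed

lemma vanishing_ideal_coset_zero:
  assumes "p \<in> carrier (mpoly_ring I)"
  shows "vanishing_ideal I V +>\<^bsub>mpoly_ring I\<^esub> p = vanishing_ideal I V \<longleftrightarrow> p \<in> vanishing_ideal I V"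
proof -
  interpret N: ideal "vanishing_ideal I V" "mpoly_ring I" by (rule vanishing_ideal_ideal)
  show ?thesis using N.a_rcos_const N.a_rcos_self[OF assms] by metis
qed

lemma coordinate_ring_simps:
  "\<zero>\<^bsub>coordinate_ring I V\<^esub> = vanishing_ideal I V"
  "carrier (coordinate_ring I V) = (\<lambda>p. vanishing_ideal I V +>\<^bsub>mpoly_ring I\<^esub> p) ` carrier (mpoly_ring I)"
  by (auto simp: coordinate_ring_def FactRing_def A_RCOSETS_def')

lemma coordinate_ring_hom:
  "ring_hom_ring (mpoly_ring I) (coordinate_ring I V) (\<lambda>p. vanishing_ideal I V +>\<^bsub>mpoly_ring I\<^esub> p)"
  unfolding coordinate_ring_def by (rule ideal.rcos_ring_hom_ring[OF vanishing_ideal_ideal])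

text \<open>Elements of \<open>L\<close> vanish on \<open>V\<close>, so \<open>\<Phi>\<close>
  followed by reduction modulo the vanishing ideal is a homomorphism \<open>h\<close> that kills
  \<open>D\<close>. It is onto by means of \<open>\<sigma>\<close>. The kernel of the induced map
  \<open>g\<close> is the nilradical: a nilpotent class has nilpotent values in \<complex>, which
  are 0; conversely, vanishing on \<open>V\<close> puts a power of \<open>\<Phi> f\<close> into
  \<open>L\<close>, and \<open>\<Phi>_in_L_iff\<close> returns that power to
  \<open>D\<close>.\<close>

theorem reduced_tensor_iso_coordinate_ring:
  fixes I :: "'v::countable set" and S :: "('v, int) mpoly set"
  assumes "S \<subseteq> carrier (mpoly_ring I)"
  defines "T \<equiv> tensor_ring (mpoly_ring I Quot (Idl\<^bsub>mpoly_ring I\<^esub> S)) (ring_of_type_algebra :: complex ring)"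
    and "V \<equiv> {x \<in> I \<rightarrow>\<^sub>E UNIV. \<forall>s\<in>S. mpoly_eval x (mpoly_of_int s) = (0 :: complex)}"
  shows "T Quot nilradical T \<simeq> coordinate_ring I V"
proof -
  interpret scalar_extension I S "ring_of_type_algebra :: complex ring"
    by unfold_locales (use assms in auto)
  let ?C = "mpoly_ring I :: ('v, complex) mpoly ring"
  let ?Q = "coordinate_ring I V"
  define N where "N = vanishing_ideal I V"
  define h where "h f = N +>\<^bsub>?C\<^esub> \<Phi> f" for f
  have T: "T = F Quot D"
    by (simp only: T_def tensor_ring_def F_def D_def A_def)
  interpret F: ring F by (rule F_ring)
  interpret D: ideal D F by (rule D_ideal)
  interpret C: cring ?C by (rule mpoly_ring_cring)
  interpret Q: ring_hom_ring ?C ?Q "\<lambda>p. N +>\<^bsub>?C\<^esub> p"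
    unfolding N_def by (rule coordinate_ring_hom)
  interpret TD: ring_hom_ring F T "\<lambda>f. D +>\<^bsub>F\<^esub> f"
    unfolding T by (rule D.rcos_ring_hom_ring)
  have eval_L: "mpoly_eval x p = 0" if "p \<in> L" "x \<in> V" for x p
    using that(1) by (rule mpoly_eval_span) (use that(2) in \<open>auto simp: V_def\<close>)
  have h_cong: "N +>\<^bsub>?C\<^esub> p = N +>\<^bsub>?C\<^esub> q"
    if "p - q \<in> L" "p \<in> carrier ?C" "q \<in> carrier ?C" for p q
    unfolding N_def
  proof (rule vanishing_ideal_cong[OF that(2,3)])
    fix x assume "x \<in> V"
    from eval_L[OF that(1) this] show "mpoly_eval x p = mpoly_eval x q"
      by (simp add: mpoly_eval_diff)
  qed
  have h_zero: "h f = \<zero>\<^bsub>?Q\<^esub> \<longleftrightarrow> (\<forall>x\<in>V. mpoly_eval x (\<Phi> f) = 0)" if "f \<in> carrier F" for f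
    using keys_\<Phi>[OF that] unfolding h_def N_def coordinate_ring_simps
    by (subst vanishing_ideal_coset_zero) (simp_all add: vanishing_ideal_def)
  have h: "ring_hom_ring F ?Q h"
  proof (intro ring_hom_ringI2 F.ring_axioms Q.S.ring_axioms ring_hom_memI)
    fix f assume f: "f \<in> carrier F"
    show "h f \<in> carrier ?Q" unfolding h_def by (rule Q.hom_closed[OF keys_\<Phi>[OF f]])
    fix g assume g: "g \<in> carrier F"
    note fg = keys_\<Phi>[OF f] keys_\<Phi>[OF g]
    have "h (f \<otimes>\<^bsub>F\<^esub> g) = N +>\<^bsub>?C\<^esub> (\<Phi> f \<otimes>\<^bsub>?C\<^esub> \<Phi> g)"
      unfolding h_def
      by (rule h_cong) (use \<Phi>_mult[OF f g] in simp, rule keys_\<Phi>[OF F.m_closed[OF f g]],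
          rule C.m_closed[OF fg])
    then show "h (f \<otimes>\<^bsub>F\<^esub> g) = h f \<otimes>\<^bsub>?Q\<^esub> h g"
      unfolding h_def Q.hom_mult[OF fg] .
    have "f \<oplus>\<^bsub>F\<^esub> g = f + g" by (simp add: F_def)
    then have "h (f \<oplus>\<^bsub>F\<^esub> g) = N +>\<^bsub>?C\<^esub> (\<Phi> f \<oplus>\<^bsub>?C\<^esub> \<Phi> g)"
      by (simp add: h_def \<Phi>_add)
    then show "h (f \<oplus>\<^bsub>F\<^esub> g) = h f \<oplus>\<^bsub>?Q\<^esub> h g"
      unfolding h_def Q.hom_add[OF fg] .
  next
    have "h \<one>\<^bsub>F\<^esub> = N +>\<^bsub>?C\<^esub> \<one>\<^bsub>?C\<^esub>"
      unfolding h_def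
      by (rule h_cong) (use \<Phi>_one in simp, rule keys_\<Phi>[OF F.one_closed], rule C.one_closed)
    then show "h \<one>\<^bsub>F\<^esub> = \<one>\<^bsub>?Q\<^esub>" unfolding Q.hom_one .
  qed
  have h_D: "h d = \<zero>\<^bsub>?Q\<^esub>" if "d \<in> D" for d
    using h_zero[OF D.a_Hcarr[OF that]] eval_L[OF \<Phi>_D[OF that]] by blast
  define g where "g = (\<lambda>U. the_elem (h ` U))"
  have g_coset: "g (D +>\<^bsub>F\<^esub> f) = h f" if "f \<in> carrier F" for f
    unfolding g_def by (rule ring_hom_factor_apply[OF h D_ideal h_D that])
  interpret g: ring_hom_ring T ?Q g
    unfolding g_def T by (rule ring_hom_factor_hom[OF h D_ideal h_D])
  have carrier_T: "carrier T = (\<lambda>f. D +>\<^bsub>F\<^esub> f) ` carrier F"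
    unfolding T FactRing_def A_RCOSETS_def' by auto
  have "g ` carrier T = carrier ?Q"
  proof
    show "carrier ?Q \<subseteq> g ` carrier T"
    proof
      fix u assume "u \<in> carrier ?Q"
      then obtain p where p: "p \<in> carrier ?C" "u = N +>\<^bsub>?C\<^esub> p"
        unfolding coordinate_ring_simps N_def by blast
      have "h (\<sigma> p) = u"
        unfolding h_def p(2) by (rule h_cong[OF \<Phi>_\<sigma>[OF p(1)] keys_\<Phi>[OF \<sigma>_carrier] p(1)])
      then have "u = g (D +>\<^bsub>F\<^esub> \<sigma> p)" using g_coset[OF \<sigma>_carrier] by simp
      then show "u \<in> g ` carrier T" unfolding carrier_T using \<sigma>_carrier by blast
    qed
  qed (use g.hom_closed in blast)
  then have iso: "T Quot (a_kernel T ?Q g) \<simeq> ?Q"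
    by (rule g.FactRing_iso)
  have "t \<in> nilradical T \<longleftrightarrow> g t = \<zero>\<^bsub>?Q\<^esub>" if t_carrier: "t \<in> carrier T" for t
  proof -
    obtain f where f: "f \<in> carrier F" and t: "t = D +>\<^bsub>F\<^esub> f"
      using t_carrier unfolding carrier_T by blast
    have zero_T: "\<zero>\<^bsub>T\<^esub> = D" unfolding T FactRing_def by simp
    show ?thesis
    proof
      assume "t \<in> nilradical T"
      then obtain k :: nat where "t [^]\<^bsub>T\<^esub> k = \<zero>\<^bsub>T\<^esub>"
        unfolding nilradical_def by blast
      then have "D +>\<^bsub>F\<^esub> (f [^]\<^bsub>F\<^esub> k) = D"
        unfolding t zero_T TD.hom_nat_pow[OF f] .
      with D.a_rcos_self[OF F.nat_pow_closed[OF f, of k]] have "f [^]\<^bsub>F\<^esub> k \<in> D"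
        by (simp only:)
      then have "\<Phi> (f [^]\<^bsub>F\<^esub> k) \<in> L" by (rule \<Phi>_D)
      then have "mpoly_eval x (\<Phi> f) ^ k = 0" if "x \<in> V" for x
        using eval_L[OF _ that] eval_L[OF \<Phi>_pow[OF f, of k] that]
        by (simp add: mpoly_eval_diff mpoly_eval_power)
      then show "g t = \<zero>\<^bsub>?Q\<^esub>"
        unfolding t g_coset[OF f] h_zero[OF f] by auto
    next
      assume "g t = \<zero>\<^bsub>?Q\<^esub>"
      then have vanishing: "mpoly_eval x (\<Phi> f) = 0" if "x \<in> V" for x
        using that unfolding t g_coset[OF f] h_zero[OF f] by blast
      have "\<exists>k. \<Phi> f ^ k \<in> L"
      proof (rule nullstellensatz[OF uncountable_UNIV_complex])
        fix x :: "'v \<Rightarrow> complex"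
        assume x: "\<And>s. s \<in> mpoly_of_int ` S \<Longrightarrow> mpoly_eval x s = 0"
        have "mpoly_eval (restrict x I) (mpoly_of_int s) = 0" if "s \<in> S" for s
        proof -
          have "mpoly_of_int s \<in> carrier ?C"
            using keys_mpoly_of_int[of s] S_carrier that by auto
          then show ?thesis using x that by (subst mpoly_eval_restrict) auto
        qed
        then have "mpoly_eval (restrict x I) (\<Phi> f) = 0"
          by (intro vanishing) (simp add: V_def)
        then show "mpoly_eval x (\<Phi> f) = 0"
          unfolding mpoly_eval_restrict[OF keys_\<Phi>[OF f]] .
      qed
      then obtain k where "\<Phi> f ^ k \<in> L" ..
      then have "\<Phi> (f [^]\<^bsub>F\<^esub> k) \<in> L"
        using mult_module.span_add[OF \<Phi>_pow[OF f, of k], of "\<Phi> f ^ k"] by simp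
      then have "f [^]\<^bsub>F\<^esub> k \<in> D"
        unfolding \<Phi>_in_L_iff[OF F.nat_pow_closed[OF f]] .
      then have "t [^]\<^bsub>T\<^esub> k = \<zero>\<^bsub>T\<^esub>"
        unfolding t zero_T TD.hom_nat_pow[OF f, symmetric] by (rule D.a_rcos_const)
      then show "t \<in> nilradical T" unfolding nilradical_def using t_carrier by blast
    qed
  qed
  moreover have "nilradical T \<subseteq> carrier T"
    unfolding nilradical_def by blast
  ultimately have "a_kernel T ?Q g = nilradical T"
    unfolding a_kernel_def' by blast
  then show ?thesis using iso by (simp only:)
qed

section \<open>Rescaling coordinates\<close>

text \<open>The substitution of \<open>y v\<close> times the variable for each variable
  \<open>v\<close>. It acts diagonally on monomials, so it can be given coefficientwise.\<close>

definition rescale :: "('v \<Rightarrow> 'a) \<Rightarrow> ('v, 'a::comm_ring_1) mpoly \<Rightarrow> ('v, 'a) mpoly" where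
  "rescale y = Poly_Mapping.mapp (\<lambda>m c. monom_eval y m * c)"

lemma lookup_rescale: "Poly_Mapping.lookup (rescale y p) m = monom_eval y m * Poly_Mapping.lookup p m"
  by (simp add: rescale_def lookup_mapp when_def in_keys_iff)

lemma rescale_add: "rescale y (p + q) = rescale y p + rescale y q"
  by (rule poly_mapping_eqI) (simp add: lookup_rescale lookup_add distrib_left)

lemma rescale_single: "rescale y (Poly_Mapping.single m c) = Poly_Mapping.single m (monom_eval y m * c)"
  by (rule poly_mapping_eqI) (auto simp: lookup_rescale lookup_single when_def)

lemma rescale_zero [simp]: "rescale y 0 = 0"
  by (rule poly_mapping_eqI) (simp add: lookup_rescale)

lemma rescale_one: "rescale y 1 = 1"
  using rescale_single[of y 0 1] by simp

lemma rescale_mult: "rescale y (p * q) = rescale y p * rescale y q"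
proof (induction p rule: poly_mapping_additive_induct)
  case (single m c)
  show ?case
    by (induction q rule: poly_mapping_additive_induct)
       (simp_all add: rescale_add rescale_single mult_single monom_eval_add algebra_simps)
qed (simp_all add: rescale_add algebra_simps)

lemma mpoly_eval_rescale: "mpoly_eval x (rescale y p) = mpoly_eval (\<lambda>v. y v * x v) p"
  by (induction p rule: poly_mapping_additive_induct)
     (simp_all add: rescale_add rescale_single mpoly_eval_add monom_eval_mult)

lemma keys_rescale: "Poly_Mapping.keys (rescale y p) \<subseteq> Poly_Mapping.keys p"
  by (auto simp: in_keys_iff lookup_rescale)

lemma rescale_involution:
  assumes "\<And>v. y v * y v = 1"
  shows "rescale y (rescale y p) = p"
proof (rule poly_mapping_eqI)
  fix m
  have "monom_eval y m * monom_eval y m = 1"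
    using monom_eval_mult[of y y m] assms by (simp add: monom_eval_def)
  then show "Poly_Mapping.lookup (rescale y (rescale y p)) m = Poly_Mapping.lookup p m"
    by (simp add: lookup_rescale flip: mult.assoc)
qed

text \<open>The pullback along the coordinate scaling from \<open>W\<close> to \<open>V\<close>:
  \<open>rescale y p\<close> vanishes on \<open>W\<close> exactly when \<open>p\<close> vanishes on
  \<open>V\<close>. It is onto because \<open>rescale y\<close> is its own inverse.\<close>

lemma coordinate_ring_rescale_iso:
  fixes I :: "'v set"
  assumes y: "\<And>v. y v * y v = 1"
    and V: "V = (\<lambda>x. restrict (\<lambda>v. y v * x v) I) ` W"
  shows "coordinate_ring I V \<simeq> coordinate_ring I W"
proof -
  let ?C = "mpoly_ring I :: ('v, complex) mpoly ring"
  let ?h = "\<lambda>p. vanishing_ideal I W +>\<^bsub>?C\<^esub> rescale y p"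
  interpret C: cring ?C by (rule mpoly_ring_cring)
  interpret Q: ring_hom_ring ?C "coordinate_ring I W" "\<lambda>p. vanishing_ideal I W +>\<^bsub>?C\<^esub> p"
    by (rule coordinate_ring_hom)
  have closed: "rescale y p \<in> carrier ?C" if "p \<in> carrier ?C" for p
    using that keys_rescale[of y p] by auto
  interpret h: ring_hom_ring ?C "coordinate_ring I W" ?h
  proof (intro ring_hom_ringI2 C.ring_axioms Q.S.ring_axioms ring_hom_memI)
    fix p assume p: "p \<in> carrier ?C"
    show "?h p \<in> carrier (coordinate_ring I W)" by (rule Q.hom_closed[OF closed[OF p]])
    fix q assume q: "q \<in> carrier ?C"
    show "?h (p \<otimes>\<^bsub>?C\<^esub> q) = ?h p \<otimes>\<^bsub>coordinate_ring I W\<^esub> ?h q"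
      using Q.hom_mult[OF closed[OF p] closed[OF q]] by (simp add: rescale_mult)
    show "?h (p \<oplus>\<^bsub>?C\<^esub> q) = ?h p \<oplus>\<^bsub>coordinate_ring I W\<^esub> ?h q"
      using Q.hom_add[OF closed[OF p] closed[OF q]] by (simp add: rescale_add)
  next
    show "?h \<one>\<^bsub>?C\<^esub> = \<one>\<^bsub>coordinate_ring I W\<^esub>"
      using Q.hom_one by (simp add: rescale_one)
  qed
  have "carrier (coordinate_ring I W) \<subseteq> ?h ` carrier ?C"
  proof
    fix u assume "u \<in> carrier (coordinate_ring I W)"
    then obtain p where p: "p \<in> carrier ?C" "u = vanishing_ideal I W +>\<^bsub>?C\<^esub> p"
      unfolding coordinate_ring_simps by blast
    then have "u = ?h (rescale y p)" by (simp only: rescale_involution[OF y])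
    then show "u \<in> ?h ` carrier ?C" using closed[OF p(1)] by blast
  qed
  then have "?h ` carrier ?C = carrier (coordinate_ring I W)"
    using h.hom_closed by blast
  then have "?C Quot (a_kernel ?C (coordinate_ring I W) ?h) \<simeq> coordinate_ring I W"
    by (rule h.FactRing_iso)
  moreover have "a_kernel ?C (coordinate_ring I W) ?h = vanishing_ideal I V"
  proof -
    have "?h p = \<zero>\<^bsub>coordinate_ring I W\<^esub> \<longleftrightarrow> p \<in> vanishing_ideal I V" if p: "p \<in> carrier ?C" for p
      unfolding coordinate_ring_simps vanishing_ideal_coset_zero[OF closed[OF p]]
      unfolding vanishing_ideal_def V
      using p closed[OF p] mpoly_eval_restrict[OF p] by (auto simp: mpoly_eval_rescale)
    then show ?thesis
      unfolding a_kernel_def' by (auto simp: vanishing_ideal_def)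
  qed
  ultimately show ?thesis by (simp add: coordinate_ring_def)
qed

section \<open>Knot contact homology\<close>

lemma contact_gen_carrier:
  assumes "i \<in> {1..n}" "j \<in> {1..n}"
  shows "contact_gen i j \<in> carrier (mpoly_ring (label_pairs n))"
  using assms by (auto simp: contact_gen_def sym_ext_def mpoly_const_def mpoly_var_def label_pairs_def)

lemma contact_relations_carrier:
  assumes "W \<subseteq> {1..n} \<times> {1..n} \<times> {1..n}"
  shows "contact_relations n W \<subseteq> carrier (mpoly_ring (label_pairs n))"
proof -
  interpret R: cring "mpoly_ring (label_pairs n) :: (nat \<times> nat, int) mpoly ring"
    by (rule mpoly_ring_cring)
  have "contact_gen l j + contact_gen l k + contact_gen l i * contact_gen i j
      \<in> carrier (mpoly_ring (label_pairs n))" if "(i, j, k) \<in> W" "l \<in> {1..n}" for i j k l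
  proof -
    have "i \<in> {1..n}" "j \<in> {1..n}" "k \<in> {1..n}" using that assms by auto
    then have "contact_gen l j \<oplus>\<^bsub>mpoly_ring (label_pairs n)\<^esub> contact_gen l k
        \<oplus>\<^bsub>mpoly_ring (label_pairs n)\<^esub>
          contact_gen l i \<otimes>\<^bsub>mpoly_ring (label_pairs n)\<^esub> contact_gen i j
        \<in> carrier (mpoly_ring (label_pairs n))"
      by (intro R.a_closed R.m_closed contact_gen_carrier that)
    then show ?thesis unfolding mpoly_ring_simps(2,3) .
  qed
  then show ?thesis unfolding contact_relations_def by blast
qed

lemma wirtinger_triples_subset: "wirtinger_triples K n lab \<subseteq> {1..n} \<times> {1..n} \<times> {1..n}"
  unfolding wirtinger_triples_def by blast

lemma mpoly_eval_contact_gen: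
  "mpoly_eval x (mpoly_of_int (contact_gen i j)) = sym_ext (- 2) x i j"
  by (simp add: contact_gen_def sym_ext_def mpoly_const_def mpoly_var_def monom_eval_def)

lemma sym_ext_uminus:
  assumes "i \<in> {1..n}" "j \<in> {1..n}"
  shows "sym_ext 2 (restrict (\<lambda>v. - 1 * x v) (label_pairs n)) i j = - sym_ext (- 2 :: complex) x i j"
  using assms by (auto simp: sym_ext_def label_pairs_def)

text \<open>Negation of points is an involution that turns the diagonal convention -2 into 2. The
  linear terms of a contact relation change sign and the product does not, which gives the equation
  of the variety up to sign. The form \<open>- 1 * x v\<close> matches a rescaling by the constant
  \<open>- 1\<close>.\<close>

lemma fundamental_variety_alt:
  "fundamental_variety K n lab =
    (\<lambda>x. restrict (\<lambda>v. - 1 * x v) (label_pairs n)) `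
      {x \<in> label_pairs n \<rightarrow>\<^sub>E UNIV. \<forall>s\<in>contact_relations n (wirtinger_triples K n lab).
        mpoly_eval x (mpoly_of_int s) = 0}"
  (is "?V = ?neg ` ?U")
proof -
  let ?W = "wirtinger_triples K n lab"
  have relation: "sym_ext 2 (?neg x) a k - sym_ext 2 (?neg x) i j * sym_ext 2 (?neg x) a i
        + sym_ext 2 (?neg x) a j =
      - mpoly_eval x (mpoly_of_int (contact_gen a j + contact_gen a k + contact_gen a i * contact_gen i j))"
    if "(i, j, k) \<in> ?W" "a \<in> {1..n}" for x :: "nat \<times> nat \<Rightarrow> complex" and a i j k
  proof -
    have "i \<in> {1..n}" "j \<in> {1..n}" "k \<in> {1..n}" using that wirtinger_triples_subset by blast+
    then show ?thesis
      using that(2) by (simp only: sym_ext_uminus mpoly_of_int_add mpoly_of_int_mult mpoly_eval_add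
          mpoly_eval_mult mpoly_eval_contact_gen) (simp add: algebra_simps)
  qed
  have neg: "?neg x \<in> ?V \<longleftrightarrow> x \<in> ?U" if "x \<in> label_pairs n \<rightarrow>\<^sub>E UNIV" for x
  proof -
    have "?neg x \<in> ?V \<longleftrightarrow> (\<forall>(i, j, k)\<in>?W. \<forall>a\<in>{1..n}. mpoly_eval x
        (mpoly_of_int (contact_gen a j + contact_gen a k + contact_gen a i * contact_gen i j)) = 0)"
      unfolding fundamental_variety_def using relation by fastforce
    also have "\<dots> \<longleftrightarrow> x \<in> ?U"
      using that unfolding contact_relations_def by blast
    finally show ?thesis .
  qed
  have neg_neg: "?neg (?neg x) = x" if "x \<in> label_pairs n \<rightarrow>\<^sub>E UNIV" for x :: "nat \<times> nat \<Rightarrow> complex"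
    using that by (auto simp: PiE_def extensional_def restrict_def)
  show ?thesis
  proof
    show "?neg ` ?U \<subseteq> ?V" using neg by blast
    show "?V \<subseteq> ?neg ` ?U"
    proof
      fix x assume x: "x \<in> ?V"
      then have "x \<in> label_pairs n \<rightarrow>\<^sub>E UNIV" by (simp add: fundamental_variety_def)
      note eq = neg_neg[OF this]
      have "?neg x \<in> label_pairs n \<rightarrow>\<^sub>E UNIV" by simp
      from neg[OF this] have "?neg x \<in> ?U" using x unfolding eq by (rule iffD1)
      then show "x \<in> ?neg ` ?U" by (rule image_eqI[of x ?neg "?neg x", OF eq[symmetric]])
    qed
  qed
qed

theorem proposition4p2:
  fixes K :: "space set" and n :: nat and lab :: "nat \<Rightarrow> space set"
  assumes "knot K"
    and "regular_projection K"
    and "arc_labelling K n lab"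
  shows "let T = tensor_ring (HC0_ab K n lab) (ring_of_type_algebra :: complex ring)
         in (T Quot nilradical T) \<simeq>
            coordinate_ring (label_pairs n) (fundamental_variety K n lab)"
proof -
  let ?I = "label_pairs n" and ?S = "contact_relations n (wirtinger_triples K n lab)"
  let ?T = "tensor_ring (HC0_ab K n lab) (ring_of_type_algebra :: complex ring)"
  let ?U = "{x \<in> ?I \<rightarrow>\<^sub>E UNIV. \<forall>s\<in>?S. mpoly_eval x (mpoly_of_int s) = (0 :: complex)}"
  have "?T Quot nilradical ?T \<simeq> coordinate_ring ?I ?U"
    unfolding HC0_ab_def Let_def
    by (intro reduced_tensor_iso_coordinate_ring contact_relations_carrier wirtinger_triples_subset)
  moreover have "coordinate_ring ?I ?U \<simeq> coordinate_ring ?I (fundamental_variety K n lab)"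
  \<comment> \<open>Since \<open>fundamental_variety_alt\<close> presents the variety as an image of
    \<open>?U\<close>, rescaling yields the isomorphism in the opposite direction.\<close>
  proof (rule ring_iso_sym)
    show "ring (coordinate_ring ?I (fundamental_variety K n lab))"
      using coordinate_ring_hom by (rule ring_hom_ring.axioms(2))
    show "coordinate_ring ?I (fundamental_variety K n lab) \<simeq> coordinate_ring ?I ?U"
      by (rule coordinate_ring_rescale_iso[OF _ fundamental_variety_alt]) simp
  qed
  ultimately show ?thesis
    unfolding Let_def by (rule ring_iso_trans)
qed

end
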